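(* Let $N\le n$. Let $\mu_0=\sum_{i=1}^Nc_0^i\sigma^i\delta_{w_0^i}$, where $c_0^i>0$, $\sigma^i\in\{-1,+1\}$ and $w_0^i\in R_{\pi^i}\cap\mathbb{S}^{d-1}$, $\pi^i\in\{0,1\}^n$, for every $i=1,\dots,N$; let $y_0=K\mu_0$. Let $p_0$ be the minimal-norm solution of the dual interpolation problem $(D_0)$, suppose that $\eta_0=K_*p_0$ is a dual certificate for $\mu_0$, and assume that $$|\eta_0(w)|<1\quad\text{for all }w\in\mathbb{S}^{d-1}\setminus\{w_0^1,\dots,w_0^N\}.$$ Moreover, suppose that $\{K\delta_{w_0^i}\}_{i=1}^N$ are linearly independent and that the linear map $$\begin{bmatrix}\mathbf K(w_0)\\ \mathbf K'(w_0)\end{bmatrix}:\mathbb{R}^n\to\mathbb{R}^N\times\prod_{i=1}^NT_{w_0^i}\mathbb{S}^{d-1}$$ has full rank $Nd$. Then there exist $\alpha>0$, $\lambda_0>0$ such that, for all $(\lambda,\zeta)\in N_{\alpha,\lambda_0}$, the solution $\mu_{\lambda,\zeta}$ of the training problem $(P_\lambda)$ with $y_\zeta=y_0+\zeta$ is unique and admits a unique representation of the form $$\mu_{\lambda,\zeta}=\sum_{i=1}^Nc_{\lambda,\zeta}^i\sigma^i\delta_{w_{\lambda,\zeta}^i},$$ where $w_{\lambda,\zeta}^i\in R_{\pi^i}\cap\mathbb{S}^{d-1}$, $\eta_{\lambda,\zeta}(w_{\lambda,\zeta}^i)=\sigma^i$ and $c_{\lambda,\zeta}^i>0$. Moreover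 (with the points suitably indexed), for every $i=1,\dots,N$ and all $(\lambda,\zeta)\in N_{\alpha,\lambda_0}$, $$|c_{\lambda,\zeta}^i-c_0^i|=O(\lambda),\qquad \|w_{\lambda,\zeta}^i-w_0^i\|=O(\lambda),$$ i.e. there is a constant $C>0$ independent of $(\lambda,\zeta)\in N_{\alpha,\lambda_0}$ such that both quantities are at most $C\lambda$.
   Context: Setting. $d,n$ are positive integers, $x^1,\dots,x^n\in\mathbb{R}^d\setminus\{0\}$ are given data points, and $\sigma(z)=\max\{0,z\}$ is the ReLU function (the $\sigma^i$ are signs). $M(\mathbb{S}^{d-1})$ is the space of finite signed Radon measures on the unit sphere $\mathbb{S}^{d-1}\subset\mathbb{R}^d$, with total variation norm $\|\cdot\|_{\mathrm{TV}}$. $K:M(\mathbb{S}^{d-1})\to\mathbb{R}^n$ is $(K\mu)_j=\int_{\mathbb{S}^{d-1}}\sigma(\langle w,x^j\rangle)\,d\mu(w)$, and $K_*:\mathbb{R}^n\to C(\mathbb{S}^{d-1})$ is $K_*p(w)=\sum_{j=1}^np^j\sigma(\langle w,x^j\rangle)$. For $\pi\in\{0,1\}^n$, the dual region $R_\pi$ is the open set of $w\in\mathbb{R}^d$ such that for every $j$, $\langle w,x^j\rangle>0$ if $\pi_j=1$ and $\langle w,x^j\rangle<0$ if $\pi_j=0$. Dual interpolation problem $(D_0)$: maximize $\langle p,y_0\rangle$ over $p\in\mathbb{R}^n$ with $\|K_*p\|_\infty\le1$; its minimal-norm solution is the solution of smallest Euclidean norm. $\eta_0=K_*p_0$ is a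 dual certificate for $\mu_0$ if $\|\eta_0\|_\infty\le1$ and $\int\eta_0\,d\mu_0=\|\mu_0\|_{\mathrm{TV}}$ (so $\mu_0$ then minimizes $\|\mu\|_{\mathrm{TV}}$ subject to $K\mu=y_0$). Training problem $(P_\lambda)$, $\lambda>0$: minimize $\frac12\|K\mu-y_\zeta\|^2+\lambda\|\mu\|_{\mathrm{TV}}$ over $\mu\in M(\mathbb{S}^{d-1})$, with $y_\zeta=y_0+\zeta$. Its dual: maximize $\langle y_\zeta,p\rangle-\frac\lambda2\|p\|^2$ over $p\in\mathbb{R}^n$ with $\|K_*p\|_\infty\le1$; $p_{\lambda,\zeta}$ is its unique solution and $\eta_{\lambda,\zeta}=K_*p_{\lambda,\zeta}$. Admissible parameters: $N_{\alpha,\lambda_0}=\{(\lambda,\zeta)\in\mathbb{R}_+\times\mathbb{R}^n:0<\lambda\le\lambda_0,\ \|\zeta\|\le\alpha\lambda\}$. With $w_0=(w_0^1,\dots,w_0^N)$: $\mathbf K(w_0)$ is the $N\times n$ matrix with entries $\sigma(\langle w_0^i,x^j\rangle)$, and $\mathbf K'(w_0):\mathbb{R}^n\to\prod_{i=1}^NT_{w_0^i}\mathbb{S}^{d-1}$ is the linear map $p\mapsto\big(\sum_{j=1}^np^j\,\nabla_{\mathbb{S}^{d-1}}\sigma(\langle\cdot,x^j\rangle)(w_0^i)\big)_{i=1}^N$, where $\nabla_{\mathbb{S}^{d-1}}$ is the Riemannian gradient on the sphere; since $w_0^i\in R_{\pi^i}$, $\nabla_{\mathbb{S}^{d-1}}\sigma(\langle\cdot,x^j\rangle)(w_0^i)=\pi^i_j\,(x^j-\langle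 w_0^i,x^j\rangle w_0^i)$. *)

theory Defs
  imports "HOL-Analysis.Analysis"
begin

section \<open>Finite signed measures\<close>

text \<open>
  A finite signed measure on \<open>M\<close> is a countably additive real-valued function on \<open>sets M\<close>.
  It is extended by 0 outside \<open>sets M\<close>, so that equality of signed measures is equality of
  functions. On the Borel sets of a sphere every such measure is Radon, because the sphere is a
  compact metric space.
\<close>

definition signed_measures :: "'a measure \<Rightarrow> ('a set \<Rightarrow> real) set" where
  "signed_measures M = {\<mu>. (\<forall>A. A \<notin> sets M \<longrightarrow> \<mu> A = 0) \<and>
     (\<forall>A :: nat \<Rightarrow> 'a set. range A \<subseteq> sets M \<and> disjoint_family A \<longrightarrow>
        (\<lambda>i. \<mu> (A i)) sums \<mu> (\<Union>i. A i))}"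

definition tv_norm :: "'a measure \<Rightarrow> ('a set \<Rightarrow> real) \<Rightarrow> real" where
  "tv_norm M \<mu> = (SUP P \<in> {P. finite P \<and> partition_on (space M) P \<and> P \<subseteq> sets M}. \<Sum>A\<in>P. \<bar>\<mu> A\<bar>)"

text \<open>The positive part of the Jordan decomposition; the negative part of \<open>\<mu>\<close> is the positive part
  of \<open>-\<mu>\<close>.\<close>

definition positive_part :: "'a measure \<Rightarrow> ('a set \<Rightarrow> real) \<Rightarrow> 'a measure" where
  "positive_part M \<mu> =
     measure_of (space M) (sets M) (\<lambda>A. ennreal (SUP B \<in> {B \<in> sets M. B \<subseteq> A}. \<mu> B))"

definition signed_integral :: "'a measure \<Rightarrow> ('a set \<Rightarrow> real) \<Rightarrow> ('a \<Rightarrow> real) \<Rightarrow> real" where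
  "signed_integral M \<mu> f =
     (\<integral>w. f w \<partial>positive_part M \<mu>) - (\<integral>w. f w \<partial>positive_part M (\<lambda>A. - \<mu> A))"

definition dirac :: "'a measure \<Rightarrow> 'a \<Rightarrow> 'a set \<Rightarrow> real" where
  "dirac M w A = (if A \<in> sets M \<and> w \<in> A then 1 else 0)"


section \<open>The unit sphere\<close>

abbreviation unit_sphere :: "'a::real_normed_vector set" where
  "unit_sphere \<equiv> sphere 0 1"

abbreviation sphere_borel :: "'a::real_normed_vector measure" where
  "sphere_borel \<equiv> restrict_space borel unit_sphere"

definition sphere_sup_norm :: "('a::real_normed_vector \<Rightarrow> real) \<Rightarrow> real" where
  "sphere_sup_norm f = (SUP w \<in> unit_sphere. \<bar>f w\<bar>)"

definition sphere_tangent :: "'a::real_inner \<Rightarrow> 'a set" where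
  "sphere_tangent w = {v. v \<bullet> w = 0}"

text \<open>The Riemannian gradient: the tangent vector representing the differential of the restriction
  of \<open>f\<close> to the sphere.\<close>

definition sphere_grad :: "('a::real_inner \<Rightarrow> real) \<Rightarrow> 'a \<Rightarrow> 'a" where
  "sphere_grad f w = (THE g. g \<in> sphere_tangent w \<and>
     (f has_derivative (\<lambda>v. g \<bullet> v)) (at w within unit_sphere))"

lemma sphere_grad_unique:
  fixes f :: "'a::real_inner \<Rightarrow> real"
  assumes w: "w \<in> unit_sphere"
    and g: "g \<in> sphere_tangent w" "(f has_derivative (\<lambda>v. g \<bullet> v)) (at w within unit_sphere)"
    and h: "h \<in> sphere_tangent w" "(f has_derivative (\<lambda>v. h \<bullet> v)) (at w within unit_sphere)"
  shows "g = h"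
proof (rule ccontr)
  assume ne: "g \<noteq> h"
  define v where "v = (g - h) /\<^sub>R norm (g - h)"
  have v: "norm v = 1" "v \<bullet> w = 0"
    using ne g(1) h(1) by (auto simp: v_def sphere_tangent_def inner_diff_left)
  define \<gamma> where "\<gamma> t = cos t *\<^sub>R w + sin t *\<^sub>R v" for t :: real
  have n1: "v \<bullet> v = 1" "w \<bullet> w = 1" "w \<bullet> v = 0"
    using v w by (auto simp: inner_commute simp flip: power2_norm_eq_inner)
  have \<gamma>_sphere: "\<gamma> t \<in> unit_sphere" for t
  proof -
    have "(norm (\<gamma> t))\<^sup>2 = (cos t)\<^sup>2 + (sin t)\<^sup>2"
      unfolding power2_norm_eq_inner \<gamma>_def
      using n1 v by (simp add: inner_add_left inner_add_right power2_eq_square)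
    then show ?thesis by (simp add: power2_eq_1_iff) (use norm_ge_zero[of "\<gamma> t"] in linarith)
  qed
  have \<gamma>_deriv: "(\<gamma> has_derivative (\<lambda>t. t *\<^sub>R v)) (at 0)"
    unfolding \<gamma>_def by (auto intro!: derivative_eq_intros)
  have \<gamma>_at_0: "\<gamma> 0 = w" by (simp add: \<gamma>_def)
  have comp: "((\<lambda>t. f (\<gamma> t)) has_derivative (\<lambda>t. u \<bullet> (t *\<^sub>R v))) (at 0)"
    if "(f has_derivative (\<lambda>v. u \<bullet> v)) (at w within unit_sphere)" for u
  proof (rule has_derivative_in_compose[where g = f])
    show "(f has_derivative (\<lambda>v. u \<bullet> v)) (at (\<gamma> 0) within range \<gamma>)"
      unfolding \<gamma>_at_0 using that by (rule has_derivative_subset) (use \<gamma>_sphere in blast)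
  qed (rule \<gamma>_deriv)
  have "(\<lambda>t. g \<bullet> (t *\<^sub>R v)) = (\<lambda>t. h \<bullet> (t *\<^sub>R v))"
    using comp[OF g(2)] comp[OF h(2)] by (rule has_derivative_unique)
  from fun_cong[OF this, of 1] have "(g - h) \<bullet> v = 0" by (simp add: inner_diff_left)
  then have "(g - h) \<bullet> (g - h) = 0" using ne by (auto simp: v_def)
  with ne show False by simp
qed


section \<open>The network operators\<close>

definition relu :: "real \<Rightarrow> real" where
  "relu z = max 0 z"

lemma sphere_grad_relu:
  fixes x w :: "'a::real_inner"
  assumes w: "w \<in> unit_sphere" and ne: "w \<bullet> x \<noteq> 0"
  shows "sphere_grad (\<lambda>v. relu (v \<bullet> x)) w = (if w \<bullet> x > 0 then x - (w \<bullet> x) *\<^sub>R w else 0)"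
proof -
  let ?S = "unit_sphere :: 'a set"
  let ?g = "if w \<bullet> x > 0 then x - (w \<bullet> x) *\<^sub>R w else 0"
  have ww: "w \<bullet> w = 1" using w by (simp flip: power2_norm_eq_inner)
  have tangent: "?g \<in> sphere_tangent w"
    using ww by (simp add: sphere_tangent_def inner_diff_left inner_commute[of x w])
  have deriv: "((\<lambda>v. relu (v \<bullet> x)) has_derivative (\<lambda>v. ?g \<bullet> v)) (at w within ?S)"
  proof (cases "w \<bullet> x > 0")
    case True
    text \<open>On the sphere \<open>v \<bullet> v = 1\<close>, so adding a multiple of \<open>v \<bullet> v - 1\<close> changes nothing.\<close>
    have "((\<lambda>v. v \<bullet> x - (w \<bullet> x) / 2 * (v \<bullet> v - 1)) has_derivative (\<lambda>v. ?g \<bullet> v)) (at w within ?S)"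
      using True by (auto intro!: derivative_eq_intros
          simp: fun_eq_iff inner_diff_left inner_diff_right inner_commute field_simps)
    moreover have "open {v. 0 < v \<bullet> x}" by (intro open_Collect_less continuous_intros)
    then have "\<forall>\<^sub>F v in at w within ?S. v \<bullet> x - (w \<bullet> x) / 2 * (v \<bullet> v - 1) = relu (v \<bullet> x)"
      unfolding eventually_at_topological using True
      by (intro exI[of _ "{v. 0 < v \<bullet> x}"]) (auto simp: relu_def simp flip: power2_norm_eq_inner)
    ultimately show ?thesis
      by (rule has_derivative_transform_eventually) (use True ww w in \<open>auto simp: relu_def\<close>)
  next
    case False
    with ne have neg: "w \<bullet> x < 0" by simp
    have "((\<lambda>v. 0) has_derivative (\<lambda>v. ?g \<bullet> v)) (at w within ?S)"
      using False by simp
    moreover have "open {v. v \<bullet> x < 0}" by (intro open_Collect_less continuous_intros)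
    then have "\<forall>\<^sub>F v in at w within ?S. 0 = relu (v \<bullet> x)"
      unfolding eventually_at_topological using neg
      by (intro exI[of _ "{v. v \<bullet> x < 0}"]) (auto simp: relu_def)
    ultimately show ?thesis
      by (rule has_derivative_transform_eventually) (use neg w in \<open>auto simp: relu_def\<close>)
  qed
  show ?thesis
    unfolding sphere_grad_def
    by (rule the_equality) (use tangent deriv sphere_grad_unique[OF w] in blast)+
qed

definition K_op :: "('n::finite \<Rightarrow> real^'d) \<Rightarrow> ((real^'d) set \<Rightarrow> real) \<Rightarrow> real^'n" where
  "K_op x \<mu> = (\<chi> j. signed_integral sphere_borel \<mu> (\<lambda>w. relu (w \<bullet> x j)))"

definition K_adj :: "('n::finite \<Rightarrow> real^'d) \<Rightarrow> real^'n \<Rightarrow> real^'d \<Rightarrow> real" where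
  "K_adj x p w = (\<Sum>j\<in>UNIV. p $ j * relu (w \<bullet> x j))"

text \<open>The value \<open>\<pi> j = True\<close> encodes \<open>\<pi>\<^sub>j = 1\<close>, and \<open>False\<close> encodes 0.\<close>

definition dual_region :: "('n::finite \<Rightarrow> real^'d) \<Rightarrow> ('n \<Rightarrow> bool) \<Rightarrow> (real^'d) set" where
  "dual_region x \<pi> = {w. \<forall>j. (\<pi> j \<longrightarrow> w \<bullet> x j > 0) \<and> (\<not> \<pi> j \<longrightarrow> w \<bullet> x j < 0)}"

definition spike_measure ::
  "('i::finite \<Rightarrow> real) \<Rightarrow> ('i \<Rightarrow> real) \<Rightarrow> ('i \<Rightarrow> real^'d) \<Rightarrow> (real^'d) set \<Rightarrow> real" where
  "spike_measure c s w = (\<lambda>A. \<Sum>i\<in>UNIV. c i * s i * dirac sphere_borel (w i) A)"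

definition K_mat :: "('n::finite \<Rightarrow> real^'d) \<Rightarrow> ('i::finite \<Rightarrow> real^'d) \<Rightarrow> real^'n^'i" where
  "K_mat x w = (\<chi> i j. relu (w i \<bullet> x j))"

text \<open>The product of the tangent spaces at the points \<open>w i\<close> is regarded as a subspace of
  \<open>real^'d^'i\<close>; this does not affect the rank.\<close>

definition K_deriv ::
  "('n::finite \<Rightarrow> real^'d) \<Rightarrow> ('i::finite \<Rightarrow> real^'d) \<Rightarrow> real^'n \<Rightarrow> real^'d^'i" where
  "K_deriv x w p = (\<chi> i. \<Sum>j\<in>UNIV. p $ j *\<^sub>R sphere_grad (\<lambda>v. relu (v \<bullet> x j)) (w i))"


section \<open>Training problem and dual problems\<close>

definition dual_feasible :: "('n::finite \<Rightarrow> real^'d) \<Rightarrow> (real^'n) set" where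
  "dual_feasible x = {p. sphere_sup_norm (K_adj x p) \<le> 1}"

definition dual_interp_solutions :: "('n::finite \<Rightarrow> real^'d) \<Rightarrow> real^'n \<Rightarrow> (real^'n) set" where
  "dual_interp_solutions x y = {p. is_arg_max (\<lambda>p. p \<bullet> y) (\<lambda>p. p \<in> dual_feasible x) p}"

definition min_norm_dual_interp_solution ::
  "('n::finite \<Rightarrow> real^'d) \<Rightarrow> real^'n \<Rightarrow> real^'n \<Rightarrow> bool" where
  "min_norm_dual_interp_solution x y p \<longleftrightarrow>
     is_arg_min norm (\<lambda>p. p \<in> dual_interp_solutions x y) p"

text \<open>Being a dual certificate is meant for functions of the form \<open>\<eta> = K_adj x p\<close>.\<close>

definition dual_certificate ::
  "(real^'d \<Rightarrow> real) \<Rightarrow> ((real^'d) set \<Rightarrow> real) \<Rightarrow> bool" where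
  "dual_certificate \<eta> \<mu> \<longleftrightarrow>
     sphere_sup_norm \<eta> \<le> 1 \<and> signed_integral sphere_borel \<mu> \<eta> = tv_norm sphere_borel \<mu>"

definition training_solution ::
  "('n::finite \<Rightarrow> real^'d) \<Rightarrow> real \<Rightarrow> real^'n \<Rightarrow> ((real^'d) set \<Rightarrow> real) \<Rightarrow> bool" where
  "training_solution x lam y \<mu> \<longleftrightarrow>
     is_arg_min (\<lambda>\<mu>. 1 / 2 * (norm (K_op x \<mu> - y))\<^sup>2 + lam * tv_norm sphere_borel \<mu>)
       (\<lambda>\<mu>. \<mu> \<in> signed_measures sphere_borel) \<mu>"

definition training_dual_objective :: "real \<Rightarrow> real^'n \<Rightarrow> real^'n \<Rightarrow> real" where
  "training_dual_objective lam y p = y \<bullet> p - lam / 2 * (norm p)\<^sup>2"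

definition training_dual_solution ::
  "('n::finite \<Rightarrow> real^'d) \<Rightarrow> real \<Rightarrow> real^'n \<Rightarrow> real^'n" where
  "training_dual_solution x lam y = arg_max (training_dual_objective lam y) (\<lambda>p. p \<in> dual_feasible x)"

definition admissible :: "real \<Rightarrow> real \<Rightarrow> (real \<times> (real^'n)) set" where
  "admissible \<alpha> lam\<^sub>0 = {(lam, \<zeta>). 0 < lam \<and> lam \<le> lam\<^sub>0 \<and> norm \<zeta> \<le> \<alpha> * lam}"

lemma sphere_sup_norm_le_iff:
  "sphere_sup_norm (K_adj x p) \<le> 1 \<longleftrightarrow> (\<forall>w\<in>unit_sphere. \<bar>K_adj x p w\<bar> \<le> 1)"
proof -
  have "continuous_on unit_sphere (\<lambda>w. \<bar>K_adj x p w\<bar>)"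
    unfolding K_adj_def relu_def by (intro continuous_intros)
  then have "compact ((\<lambda>w. \<bar>K_adj x p w\<bar>) ` unit_sphere)"
    by (intro compact_continuous_image) auto
  then have "bdd_above ((\<lambda>w. \<bar>K_adj x p w\<bar>) ` unit_sphere)"
    by (intro bounded_imp_bdd_above compact_imp_bounded)
  moreover have "(unit_sphere :: (real^'a) set) \<noteq> {}" by simp
  ultimately show ?thesis
    unfolding sphere_sup_norm_def by (subst cSUP_le_iff) auto
qed

lemma training_dual_solution_iff:
  assumes "lam > 0"
  shows "is_arg_max (training_dual_objective lam y) (\<lambda>p. p \<in> dual_feasible x) p \<longleftrightarrow>
    p = training_dual_solution x lam y"
proof -
  let ?F = "dual_feasible x" and ?f = "training_dual_objective lam y"
  have F: "?F = (\<Inter>w\<in>unit_sphere. {p. \<bar>K_adj x p w\<bar> \<le> 1})"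
    by (auto simp: dual_feasible_def sphere_sup_norm_le_iff)
  have cl: "closed ?F"
    unfolding F K_adj_def by (intro closed_INT ballI closed_Collect_le continuous_intros)
  have lin: "linear (\<lambda>p. K_adj x p w)" for w
    unfolding K_adj_def
    by (rule linearI) (auto simp: algebra_simps sum.distrib sum_distrib_left)
  have "{p. \<bar>K_adj x p w\<bar> \<le> 1} = (\<lambda>p. K_adj x p w) -` {-1..1}" for w by auto
  then have cv: "convex ?F"
    unfolding F by (auto intro!: convex_INT convex_linear_vimage lin)
  have "0 \<in> ?F" by (auto simp: F K_adj_def)
  then have ne: "?F \<noteq> {}" by auto
  have obj: "?f p = (norm y)\<^sup>2 / (2 * lam) - lam / 2 * (dist (y /\<^sub>R lam) p)\<^sup>2" for p
    using assms unfolding training_dual_objective_def dist_norm power2_norm_eq_inner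
    by (simp add: inner_diff_left inner_diff_right inner_commute field_simps)
  have less: "?f q > ?f p \<longleftrightarrow> dist (y /\<^sub>R lam) q < dist (y /\<^sub>R lam) p" for p q
    using assms by (simp add: obj flip: not_le)
  have iff: "is_arg_max ?f (\<lambda>p. p \<in> ?F) p \<longleftrightarrow> p = closest_point ?F (y /\<^sub>R lam)" for p
    using closest_point_exists[OF cl ne] closest_point_unique[OF cv cl]
    unfolding is_arg_max_def less by (metis not_le)
  then have "arg_max ?f (\<lambda>p. p \<in> ?F) = closest_point ?F (y /\<^sub>R lam)"
    unfolding arg_max_def by (intro some_equality) blast+
  with iff show ?thesis by (simp add: training_dual_solution_def)
qed

end

theory Submission
  imports Defs
begin

text \<open>
  On the dual region of the \<open>i\<close>-th spike \<open>K\<^sub>* p\<close> is linear with coefficient vector \<open>(A p)\<^sub>i\<close>, and the full rank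
  condition says exactly that \<open>A\<close> is surjective onto \<open>(\<real>\<^sup>d)\<^sup>N\<close>. A spike measure with one spike in
  each region is encoded by the vectors \<open>v\<^sub>i = c\<^sub>i \<sigma>\<^sub>i w\<^sub>i\<close>, and its image under \<open>K\<close> is \<open>A\<^sup>* v\<close>, where
  \<open>A\<^sup>*\<close> is bounded below. Minimise \<open>\<parallel>A\<^sup>* v - y\<parallel>\<^sup>2 / 2 + \<lambda> \<Sum>\<^sub>i \<parallel>v\<^sub>i\<parallel>\<close> over a small ball around the
  vector \<open>v\<^sub>0\<close> of \<open>\<mu>\<^sub>0\<close>. Comparing with \<open>v\<^sub>0\<close> gives \<open>\<parallel>v - v\<^sub>0\<parallel> = O(\<lambda>)\<close>, so the minimiser is
  interior, and stationarity says that \<open>p = (y - A\<^sup>* v) / \<lambda>\<close> satisfies \<open>(A p)\<^sub>i = \<sigma>\<^sub>i w\<^sub>i\<close>. As \<open>p\<^sub>0\<close> has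
  minimal norm it lies in the range of \<open>A\<^sup>*\<close>, which makes \<open>p - p\<^sub>0\<close> small; hence \<open>K\<^sub>* p\<close> certifies
  the optimality of the measure of \<open>v\<close>, and uniqueness follows from its saturation set and the
  injectivity of \<open>A\<^sup>*\<close>.
\<close>

section \<open>The Jordan decomposition\<close>

lemma signed_measures_outside:
  "\<mu> \<in> signed_measures M \<Longrightarrow> A \<notin> sets M \<Longrightarrow> \<mu> A = 0"
  by (simp add: signed_measures_def)

lemma signed_measures_sums:
  "\<mu> \<in> signed_measures M \<Longrightarrow> range A \<subseteq> sets M \<Longrightarrow> disjoint_family A \<Longrightarrow>
    (\<lambda>i::nat. \<mu> (A i)) sums \<mu> (\<Union>i. A i)"
  by (simp add: signed_measures_def)

lemma signed_measures_uminus: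
  assumes "\<mu> \<in> signed_measures M"
  shows "(\<lambda>A. - \<mu> A) \<in> signed_measures M"
  using assms by (auto simp: signed_measures_def intro!: sums_minus)

lemma signed_measures_empty:
  assumes "\<mu> \<in> signed_measures M"
  shows "\<mu> {} = 0"
proof -
  have "(\<lambda>i::nat. \<mu> {}) sums \<mu> (\<Union>i::nat. {})"
    by (rule signed_measures_sums[OF assms]) (auto simp: disjoint_family_on_def)
  then show ?thesis using sums_summable summable_const_iff by blast
qed

lemma signed_measures_Un:
  assumes \<mu>: "\<mu> \<in> signed_measures M" and AB: "A \<in> sets M" "B \<in> sets M" "A \<inter> B = {}"
  shows "\<mu> (A \<union> B) = \<mu> A + \<mu> B"
proof -
  have "(\<lambda>i. \<mu> (binaryset A B i)) sums \<mu> (\<Union>i. binaryset A B i)"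
    by (rule signed_measures_sums[OF \<mu>])
      (use AB in \<open>auto simp: range_binaryset_eq disjoint_family_on_def binaryset_def\<close>)
  moreover have "(\<lambda>i. \<mu> (binaryset A B i)) sums (\<mu> A + \<mu> B)"
    by (rule binaryset_sums) (rule signed_measures_empty[OF \<mu>])
  ultimately show ?thesis by (simp add: UN_binaryset_eq sums_unique2)
qed

lemma signed_measures_Diff:
  assumes \<mu>: "\<mu> \<in> signed_measures M" and AB: "A \<in> sets M" "B \<in> sets M" "B \<subseteq> A"
  shows "\<mu> (A - B) = \<mu> A - \<mu> B"
proof -
  have "\<mu> (B \<union> (A - B)) = \<mu> B + \<mu> (A - B)"
    by (rule signed_measures_Un[OF \<mu>]) (use AB in auto)
  moreover have "B \<union> (A - B) = A" using AB by auto
  ultimately show ?thesis by simp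
qed

text \<open>Otherwise some set has subsets of arbitrarily large measure. Such a set splits into a
  piece with the same property and a piece of absolute measure above 1. Repeating this yields
  disjoint pieces whose measures form a convergent series without tending to 0. The bound makes the
  real suprema below meaningful.\<close>

lemma signed_measures_bounded:
  assumes \<mu>: "\<mu> \<in> signed_measures M"
  obtains r where "\<And>B. \<bar>\<mu> B\<bar> \<le> r"
proof -
  define U where "U E \<longleftrightarrow> E \<in> sets M \<and> (\<forall>r. \<exists>B\<in>sets M. B \<subseteq> E \<and> r < \<bar>\<mu> B\<bar>)" for E
  have step: "\<exists>F. U F \<and> F \<subseteq> E \<and> 1 < \<bar>\<mu> (E - F)\<bar>" if E: "U E" for E
  proof -
    \<comment> \<open>The margin \<open>\<bar>\<mu> E\<bar> + 1\<close> puts both \<open>B\<close>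
      and \<open>E - B\<close> above 1 in absolute measure, so it does not matter which of the two
      has to be kept.\<close>
    obtain B where B: "B \<in> sets M" "B \<subseteq> E" "\<bar>\<mu> E\<bar> + 1 < \<bar>\<mu> B\<bar>"
      using E unfolding U_def by blast
    have EM: "E \<in> sets M" using E by (simp add: U_def)
    have d: "\<mu> (E - B) = \<mu> E - \<mu> B" by (rule signed_measures_Diff[OF \<mu> EM B(1,2)])
    have "U B \<or> U (E - B)"
    proof (rule ccontr)
      assume "\<not> (U B \<or> U (E - B))"
      then obtain r1 r2 where r: "\<And>C. C \<in> sets M \<Longrightarrow> C \<subseteq> B \<Longrightarrow> \<bar>\<mu> C\<bar> \<le> r1"
        "\<And>C. C \<in> sets M \<Longrightarrow> C \<subseteq> E - B \<Longrightarrow> \<bar>\<mu> C\<bar> \<le> r2"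
        using B(1) EM unfolding U_def by (metis not_less sets.Diff)
      obtain C where C: "C \<in> sets M" "C \<subseteq> E" "r1 + r2 < \<bar>\<mu> C\<bar>"
        using E unfolding U_def by blast
      have "\<mu> (C \<inter> B \<union> (C - B)) = \<mu> (C \<inter> B) + \<mu> (C - B)"
        by (rule signed_measures_Un[OF \<mu>]) (use B C in auto)
      moreover have "C \<inter> B \<union> (C - B) = C" by auto
      moreover have "\<bar>\<mu> (C \<inter> B)\<bar> \<le> r1" "\<bar>\<mu> (C - B)\<bar> \<le> r2"
        using B C by (auto intro!: r)
      ultimately have "\<bar>\<mu> C\<bar> \<le> r1 + r2" by simp
      then show False using C(3) by simp
    qed
    then show ?thesis
    proof
      assume "U B"
      then show ?thesis using B d by (intro exI[of _ B]) auto
    next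
      assume "U (E - B)"
      moreover have "E - (E - B) = B" using B by auto
      ultimately show ?thesis using B by (intro exI[of _ "E - B"]) auto
    qed
  qed
  have "\<not> U (space M)"
  proof
    assume "U (space M)"
    then have "\<exists>f. \<forall>n::nat. U (f n) \<and> (f (Suc n) \<subseteq> f n \<and> 1 < \<bar>\<mu> (f n - f (Suc n))\<bar>)"
      by (intro dependent_nat_choice) (use step in auto)
    then obtain f where f: "\<And>n::nat. U (f n)" "\<And>n. f (Suc n) \<subseteq> f n"
      "\<And>n. 1 < \<bar>\<mu> (f n - f (Suc n))\<bar>"
      by blast
    have mono: "f n \<subseteq> f m" if "m \<le> n" for m n
      using lift_Suc_antimono_le[of f, OF f(2) that] .
    have "disjoint_family (\<lambda>n. f n - f (Suc n))"
      unfolding disjoint_family_on_def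
    proof (intro ballI impI)
      fix m n :: nat assume "m \<noteq> n"
      then consider "Suc m \<le> n" | "Suc n \<le> m" by linarith
      then show "(f m - f (Suc m)) \<inter> (f n - f (Suc n)) = {}"
        by cases (use mono in blast)+
    qed
    then have "summable (\<lambda>n. \<mu> (f n - f (Suc n)))"
      using f(1) by (intro sums_summable[OF signed_measures_sums[OF \<mu>]]) (auto simp: U_def)
    then have "(\<lambda>n. \<mu> (f n - f (Suc n))) \<longlonglongrightarrow> 0" by (rule summable_LIMSEQ_zero)
    then have "\<forall>\<^sub>F n in sequentially. \<bar>\<mu> (f n - f (Suc n))\<bar> < 1"
      using tendstoD[of _ "0::real" _ 1] by auto
    then show False using f(3) by (auto simp: eventually_sequentially) (meson less_asym order_refl)
  qed
  then obtain r where r: "\<And>B. B \<in> sets M \<Longrightarrow> \<bar>\<mu> B\<bar> \<le> r"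
    using sets.sets_into_space unfolding U_def by (metis not_less sets.top)
  then have "\<bar>\<mu> B\<bar> \<le> max r 0" for B
    by (cases "B \<in> sets M") (auto simp: signed_measures_outside[OF \<mu>] max.coboundedI1)
  then show thesis by (rule that)
qed

section \<open>Positive variation of a signed measure\<close>

definition positive_variation :: "'a measure \<Rightarrow> ('a set \<Rightarrow> real) \<Rightarrow> 'a set \<Rightarrow> real" where
  "positive_variation M \<mu> A = (SUP B \<in> {B \<in> sets M. B \<subseteq> A}. \<mu> B)"

lemma positive_variation_upper:
  assumes "\<mu> \<in> signed_measures M" "B \<in> sets M" "B \<subseteq> A"
  shows "\<mu> B \<le> positive_variation M \<mu> A"
proof -
  obtain r where "\<And>B. \<bar>\<mu> B\<bar> \<le> r" using signed_measures_bounded[OF assms(1)] by blast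
  then have "bdd_above (\<mu> ` {B \<in> sets M. B \<subseteq> A})"
    by (intro bdd_aboveI[of _ r]) (auto simp: abs_le_iff)
  then show ?thesis
    unfolding positive_variation_def using assms by (intro cSUP_upper) auto
qed

lemma positive_variation_least:
  assumes "\<And>B. B \<in> sets M \<Longrightarrow> B \<subseteq> A \<Longrightarrow> \<mu> B \<le> u"
  shows "positive_variation M \<mu> A \<le> u"
  unfolding positive_variation_def
  by (rule cSUP_least) (use assms in auto)

lemma positive_variation_nonneg:
  "\<mu> \<in> signed_measures M \<Longrightarrow> 0 \<le> positive_variation M \<mu> A"
  using positive_variation_upper[of \<mu> M "{}" A] by (simp add: signed_measures_empty)

lemma positive_variation_mono:
  assumes "\<mu> \<in> signed_measures M" "A \<subseteq> B"
  shows "positive_variation M \<mu> A \<le> positive_variation M \<mu> B"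
  by (rule positive_variation_least) (use assms in \<open>auto intro: positive_variation_upper\<close>)

text \<open>Competitors inside the two disjoint sets can be chosen independently and united; the two
  suprema are taken one after the other.\<close>

lemma positive_variation_superadditive:
  assumes \<mu>: "\<mu> \<in> signed_measures M" and "A \<inter> B = {}"
  shows "positive_variation M \<mu> A + positive_variation M \<mu> B \<le> positive_variation M \<mu> (A \<union> B)"
proof -
  have "positive_variation M \<mu> A \<le> positive_variation M \<mu> (A \<union> B) - positive_variation M \<mu> B"
  proof (rule positive_variation_least)
    fix C assume C: "C \<in> sets M" "C \<subseteq> A"
    have "positive_variation M \<mu> B \<le> positive_variation M \<mu> (A \<union> B) - \<mu> C"
    proof (rule positive_variation_least)
      fix D assume D: "D \<in> sets M" "D \<subseteq> B"
      have "\<mu> (C \<union> D) = \<mu> C + \<mu> D"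
        by (rule signed_measures_Un[OF \<mu>]) (use assms C D in auto)
      moreover have "\<mu> (C \<union> D) \<le> positive_variation M \<mu> (A \<union> B)"
        by (rule positive_variation_upper[OF \<mu>]) (use C D in auto)
      ultimately show "\<mu> D \<le> positive_variation M \<mu> (A \<union> B) - \<mu> C" by simp
    qed
    then show "\<mu> C \<le> positive_variation M \<mu> (A \<union> B) - positive_variation M \<mu> B" by simp
  qed
  then show ?thesis by simp
qed

text \<open>Superadditivity bounds the partial sums, which gives summability and one inequality. For
  the other, a competitor \<open>B\<close> in the union is cut into the competitors
  \<open>B \<inter> A i\<close>.\<close>

lemma positive_variation_sums:
  assumes \<mu>: "\<mu> \<in> signed_measures M" and A: "range A \<subseteq> sets M" "disjoint_family A"
  shows "(\<lambda>i::nat. positive_variation M \<mu> (A i)) sums positive_variation M \<mu> (\<Union>i. A i)"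
proof -
  let ?v = "positive_variation M \<mu>"
  have "(\<Sum>i<n. ?v (A i)) \<le> ?v (\<Union>i<n. A i)" for n
  proof (induction n)
    case 0
    then show ?case by (simp add: positive_variation_nonneg[OF \<mu>])
  next
    case (Suc n)
    have "A i \<inter> A n = {}" if "i < n" for i
      using A(2) that by (simp add: disjoint_family_on_def)
    then have "(\<Union>i<n. A i) \<inter> A n = {}" by auto
    from positive_variation_superadditive[OF \<mu> this] Suc show ?case
      by (simp add: lessThan_Suc Un_commute)
  qed
  also have "?v (\<Union>i<n. A i) \<le> ?v (\<Union>i. A i)" for n
    by (rule positive_variation_mono[OF \<mu>]) auto
  finally have le: "(\<Sum>i<n. ?v (A i)) \<le> ?v (\<Union>i. A i)" for n .
  have sm: "summable (\<lambda>i. ?v (A i))"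
    by (rule summableI_nonneg_bounded[OF positive_variation_nonneg[OF \<mu>] le])
  have "?v (\<Union>i. A i) \<le> (\<Sum>i. ?v (A i))"
  proof (rule positive_variation_least)
    fix B assume B: "B \<in> sets M" "B \<subseteq> (\<Union>i. A i)"
    have "(\<lambda>i. \<mu> (B \<inter> A i)) sums \<mu> (\<Union>i. B \<inter> A i)"
      by (rule signed_measures_sums[OF \<mu>]) (use A B in \<open>auto simp: disjoint_family_on_def\<close>)
    also have "(\<Union>i. B \<inter> A i) = B" using B(2) by blast
    finally have "(\<lambda>i. \<mu> (B \<inter> A i)) sums \<mu> B" .
    moreover have "\<mu> (B \<inter> A i) \<le> ?v (A i)" for i
    proof (rule positive_variation_upper[OF \<mu>])
      show "B \<inter> A i \<in> sets M" using A(1) B(1) by (intro sets.Int) auto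
    qed simp
    ultimately show "\<mu> B \<le> (\<Sum>i. ?v (A i))"
      by (intro sums_le[OF _ _ summable_sums[OF sm]])
  qed
  moreover have "(\<Sum>i. ?v (A i)) \<le> ?v (\<Union>i. A i)"
    by (rule suminf_le_const[OF sm le])
  ultimately have "?v (\<Union>i. A i) = (\<Sum>i. ?v (A i))" by (rule antisym)
  with summable_sums[OF sm] show ?thesis by (simp only:)
qed

section \<open>The Jordan parts as finite measures\<close>

lemma sets_positive_part [simp, measurable_cong]: "sets (positive_part M \<mu>) = sets M"
  by (simp add: positive_part_def)

lemma space_positive_part [simp]: "space (positive_part M \<mu>) = space M"
  by (simp add: positive_part_def)

lemma borel_measurable_positive_part [simp]:
  "borel_measurable (positive_part M \<mu>) = borel_measurable M"
  by (rule measurable_cong_sets) auto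

lemma emeasure_positive_part:
  assumes \<mu>: "\<mu> \<in> signed_measures M" and A: "A \<in> sets M"
  shows "emeasure (positive_part M \<mu>) A = ennreal (positive_variation M \<mu> A)"
proof (rule emeasure_measure_of)
  show "positive_part M \<mu> = measure_of (space M) (sets M) (\<lambda>A. ennreal (positive_variation M \<mu> A))"
    by (simp add: positive_part_def positive_variation_def)
  have "positive_variation M \<mu> {} \<le> 0"
    by (rule positive_variation_least) (simp add: signed_measures_empty[OF \<mu>])
  then show "positive (sets (positive_part M \<mu>)) (\<lambda>A. ennreal (positive_variation M \<mu> A))"
    by (simp add: positive_def ennreal_eq_0_iff)
  show "countably_additive (sets (positive_part M \<mu>)) (\<lambda>A. ennreal (positive_variation M \<mu> A))"
    unfolding countably_additive_def
    by (auto intro!: suminf_ennreal_eq positive_variation_sums[OF \<mu>] positive_variation_nonneg[OF \<mu>])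
qed (use A sets.space_closed in auto)

lemma measure_positive_part:
  assumes "\<mu> \<in> signed_measures M" "A \<in> sets M"
  shows "measure (positive_part M \<mu>) A = positive_variation M \<mu> A"
  using emeasure_positive_part[OF assms] positive_variation_nonneg[OF assms(1)]
  by (simp add: measure_def)

lemma finite_measure_positive_part:
  "\<mu> \<in> signed_measures M \<Longrightarrow> finite_measure (positive_part M \<mu>)"
  by (rule finite_measureI) (simp add: emeasure_positive_part)

text \<open>Replacing a competitor \<open>B\<close> by \<open>A - B\<close> exchanges the two
  suprema up to the constant \<open>\<mu> A\<close>. The Jordan decomposition follows from this
  without constructing a Hahn set.\<close>

lemma positive_variation_uminus:
  assumes \<mu>: "\<mu> \<in> signed_measures M" and A: "A \<in> sets M"
  shows "positive_variation M (\<lambda>A. - \<mu> A) A = positive_variation M \<mu> A - \<mu> A"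
proof (rule antisym)
  show "positive_variation M (\<lambda>A. - \<mu> A) A \<le> positive_variation M \<mu> A - \<mu> A"
  proof (rule positive_variation_least)
    fix B assume B: "B \<in> sets M" "B \<subseteq> A"
    then have "\<mu> (A - B) \<le> positive_variation M \<mu> A"
      using A by (intro positive_variation_upper[OF \<mu>]) auto
    then show "- \<mu> B \<le> positive_variation M \<mu> A - \<mu> A"
      by (simp add: signed_measures_Diff[OF \<mu> A B])
  qed
  have "positive_variation M \<mu> A \<le> positive_variation M (\<lambda>A. - \<mu> A) A + \<mu> A"
  proof (rule positive_variation_least)
    fix B assume B: "B \<in> sets M" "B \<subseteq> A"
    then have "- \<mu> (A - B) \<le> positive_variation M (\<lambda>A. - \<mu> A) A"
      using A by (intro positive_variation_upper[OF signed_measures_uminus[OF \<mu>]]) auto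
    then show "\<mu> B \<le> positive_variation M (\<lambda>A. - \<mu> A) A + \<mu> A"
      by (simp add: signed_measures_Diff[OF \<mu> A B])
  qed
  then show "positive_variation M \<mu> A - \<mu> A \<le> positive_variation M (\<lambda>A. - \<mu> A) A" by simp
qed

lemma jordan_decomposition:
  assumes "\<mu> \<in> signed_measures M" "A \<in> sets M"
  shows "\<mu> A = measure (positive_part M \<mu>) A - measure (positive_part M (\<lambda>A. - \<mu> A)) A"
  using assms
  by (simp add: measure_positive_part signed_measures_uminus positive_variation_uminus)

text \<open>The upper bound is the triangle inequality for the Jordan decomposition on each block.
  For the lower bound, partitions into a set and its complement already suffice.\<close>

lemma tv_norm_eq:
  assumes \<mu>: "\<mu> \<in> signed_measures M"
  shows "tv_norm M \<mu> = measure (positive_part M \<mu>) (space M) +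
    measure (positive_part M (\<lambda>A. - \<mu> A)) (space M)"
proof -
  let ?P = "positive_part M \<mu>" and ?N = "positive_part M (\<lambda>A. - \<mu> A)"
  let ?D = "{P. finite P \<and> partition_on (space M) P \<and> P \<subseteq> sets M}"
  interpret P: finite_measure ?P by (rule finite_measure_positive_part[OF \<mu>])
  interpret N: finite_measure ?N
    by (rule finite_measure_positive_part[OF signed_measures_uminus[OF \<mu>]])
  have le: "(\<Sum>A\<in>P. \<bar>\<mu> A\<bar>) \<le> measure ?P (space M) + measure ?N (space M)" if P: "P \<in> ?D" for P
  proof -
    have dj: "disjoint_family_on (\<lambda>A. A) P"
      using P by (auto simp: partition_on_def disjoint_def disjoint_family_on_def)
    have U: "(\<Union>A\<in>P. A) = space M" using P by (auto simp: partition_on_def)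
    have "(\<Sum>A\<in>P. \<bar>\<mu> A\<bar>) \<le> (\<Sum>A\<in>P. measure ?P A + measure ?N A)"
    proof (rule sum_mono)
      fix A assume "A \<in> P"
      then have "A \<in> sets M" using P by auto
      from jordan_decomposition[OF \<mu> this] show "\<bar>\<mu> A\<bar> \<le> measure ?P A + measure ?N A"
        using measure_nonneg[of ?P A] measure_nonneg[of ?N A] by linarith
    qed
    also have "\<dots> = measure ?P (\<Union>A\<in>P. A) + measure ?N (\<Union>A\<in>P. A)"
      unfolding sum.distrib
      using P P.finite_measure_finite_Union[OF _ _ dj] N.finite_measure_finite_Union[OF _ _ dj]
      by simp
    finally show ?thesis by (simp only: U)
  qed
  have bdd: "bdd_above ((\<lambda>P. \<Sum>A\<in>P. \<bar>\<mu> A\<bar>) ` ?D)"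
    using le by (intro bdd_aboveI) auto
  have "?D \<noteq> {}"
    by (cases "space M = {}")
      (auto simp: partition_on_def disjoint_def intro: exI[of _ "{}"] exI[of _ "{space M}"])
  with le have "tv_norm M \<mu> \<le> measure ?P (space M) + measure ?N (space M)"
    unfolding tv_norm_def by (intro cSUP_least) auto
  \<comment> \<open>The right-hand side is the mass that the positive part must have if the norm is
    the sum of the two Jordan masses and \<open>\<mu> (space M)\<close> is their difference.\<close>
  moreover have "positive_variation M \<mu> (space M) \<le> (tv_norm M \<mu> + \<mu> (space M)) / 2"
  proof (rule positive_variation_least)
    fix B assume B: "B \<in> sets M" "B \<subseteq> space M"
    \<comment> \<open>The blocks of \<open>partition_on\<close> are nonempty, so the empty set is
      removed; it contributes nothing to the sum.\<close>
    let ?Q = "{B, space M - B} - {{}}"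
    have "?Q \<in> ?D" using B by (auto simp: partition_on_def disjoint_def)
    then have "(\<Sum>A\<in>?Q. \<bar>\<mu> A\<bar>) \<le> tv_norm M \<mu>"
      unfolding tv_norm_def by (rule cSUP_upper[OF _ bdd])
    moreover have "(\<Sum>A\<in>?Q. \<bar>\<mu> A\<bar>) = (\<Sum>A\<in>{B, space M - B}. \<bar>\<mu> A\<bar>)"
      by (rule sum.mono_neutral_left) (auto simp: signed_measures_empty[OF \<mu>])
    moreover have "\<dots> = \<bar>\<mu> B\<bar> + \<bar>\<mu> (space M - B)\<bar>"
    proof (cases "B = space M - B")
      case True
      then have "B = {}" by auto
      with True have "{B, space M - B} = {{}}" by simp
      then show ?thesis using \<open>B = {}\<close> True by (simp add: signed_measures_empty[OF \<mu>])
    qed simp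
    ultimately have "\<bar>\<mu> B\<bar> + \<bar>\<mu> (space M - B)\<bar> \<le> tv_norm M \<mu>" by simp
    then show "\<mu> B \<le> (tv_norm M \<mu> + \<mu> (space M)) / 2"
      using signed_measures_Diff[OF \<mu> sets.top B] by (simp add: abs_if split: if_splits)
  qed
  ultimately show ?thesis
    using positive_variation_uminus[OF \<mu> sets.top]
    by (simp add: measure_positive_part \<mu> signed_measures_uminus)
qed


section \<open>Integration against signed measures\<close>

lemma integrable_bounded_positive_part:
  fixes f :: "'a \<Rightarrow> real"
  assumes "\<mu> \<in> signed_measures M" "f \<in> borel_measurable M" "\<And>w. w \<in> space M \<Longrightarrow> \<bar>f w\<bar> \<le> b"
  shows "integrable (positive_part M \<mu>) f"
  by (rule finite_measure.integrable_const_bound[OF finite_measure_positive_part, of _ _ _ b])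
    (use assms in auto)

lemma signed_integral_sum:
  assumes \<mu>: "\<mu> \<in> signed_measures M"
    and f: "\<And>j. j \<in> J \<Longrightarrow> f j \<in> borel_measurable M"
      "\<And>j w. j \<in> J \<Longrightarrow> w \<in> space M \<Longrightarrow> \<bar>f j w\<bar> \<le> b j"
  shows "signed_integral M \<mu> (\<lambda>w. \<Sum>j\<in>J. a j * f j w) = (\<Sum>j\<in>J. a j * signed_integral M \<mu> (f j))"
proof -
  have int: "integrable (positive_part M \<nu>) (\<lambda>w. a j * f j w)"
    if "j \<in> J" "\<nu> \<in> signed_measures M" for j \<nu>
    by (intro integrable_mult_right integrable_bounded_positive_part[where b = "b j"])
      (use that f in auto)
  show ?thesis
    unfolding signed_integral_def using int[OF _ \<mu>] int[OF _ signed_measures_uminus[OF \<mu>]]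
    by (simp only: Bochner_Integration.integral_sum integral_mult_right_zero
      sum_subtractf[symmetric] right_diff_distrib)
qed

text \<open>Both integrands on the right are nonnegative, so the duality inequality and its equality
  case can be read off from this one identity.\<close>

lemma tv_norm_minus_signed_integral:
  assumes \<mu>: "\<mu> \<in> signed_measures M" and f: "f \<in> borel_measurable M"
    and b: "\<And>w. w \<in> space M \<Longrightarrow> \<bar>f w\<bar> \<le> 1"
  shows "tv_norm M \<mu> - signed_integral M \<mu> f =
    (\<integral>w. 1 - f w \<partial>positive_part M \<mu>) + (\<integral>w. 1 + f w \<partial>positive_part M (\<lambda>A. - \<mu> A))"
proof -
  note \<mu>' = signed_measures_uminus[OF \<mu>]
  interpret P: finite_measure "positive_part M \<mu>" by (rule finite_measure_positive_part[OF \<mu>])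
  interpret N: finite_measure "positive_part M (\<lambda>A. - \<mu> A)"
    by (rule finite_measure_positive_part[OF \<mu>'])
  have "integrable (positive_part M \<mu>) f" "integrable (positive_part M (\<lambda>A. - \<mu> A)) f"
    using integrable_bounded_positive_part[OF \<mu> f b] integrable_bounded_positive_part[OF \<mu>' f b]
    by blast+
  then show ?thesis
    by (simp add: tv_norm_eq[OF \<mu>] signed_integral_def)
qed

lemma signed_integral_le_tv_norm:
  assumes \<mu>: "\<mu> \<in> signed_measures M" and f: "f \<in> borel_measurable M"
    and b: "\<And>w. w \<in> space M \<Longrightarrow> \<bar>f w\<bar> \<le> 1"
  shows "signed_integral M \<mu> f \<le> tv_norm M \<mu>"
proof -
  have "0 \<le> (\<integral>w. 1 - f w \<partial>positive_part M \<mu>)"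
    "0 \<le> (\<integral>w. 1 + f w \<partial>positive_part M (\<lambda>A. - \<mu> A))"
    using b by (intro integral_nonneg_AE AE_I2; fastforce simp: abs_le_iff)+
  with tv_norm_minus_signed_integral[OF assms] show ?thesis by simp
qed

text \<open>In the equality case two nonnegative integrals add up to 0, hence each integrand
  vanishes almost everywhere.\<close>

lemma AE_positive_part_saturated:
  assumes \<mu>: "\<mu> \<in> signed_measures M" and f: "f \<in> borel_measurable M"
    and b: "\<And>w. w \<in> space M \<Longrightarrow> \<bar>f w\<bar> \<le> 1" and eq: "signed_integral M \<mu> f = tv_norm M \<mu>"
  shows "AE w in positive_part M \<mu>. f w = 1" "AE w in positive_part M (\<lambda>A. - \<mu> A). f w = - 1"
proof -
  note \<mu>' = signed_measures_uminus[OF \<mu>]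
  interpret P: finite_measure "positive_part M \<mu>" by (rule finite_measure_positive_part[OF \<mu>])
  interpret N: finite_measure "positive_part M (\<lambda>A. - \<mu> A)"
    by (rule finite_measure_positive_part[OF \<mu>'])
  have nn: "0 \<le> 1 - f w" "0 \<le> 1 + f w" if "w \<in> space M" for w
    using b[OF that] by auto
  have "integrable (positive_part M \<mu>) f" "integrable (positive_part M (\<lambda>A. - \<mu> A)) f"
    using integrable_bounded_positive_part[OF \<mu> f b] integrable_bounded_positive_part[OF \<mu>' f b]
    by blast+
  then have int: "integrable (positive_part M \<mu>) (\<lambda>w. 1 - f w)"
    "integrable (positive_part M (\<lambda>A. - \<mu> A)) (\<lambda>w. 1 + f w)"
    by auto
  have ae: "AE w in positive_part M \<mu>. 0 \<le> 1 - f w"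
    "AE w in positive_part M (\<lambda>A. - \<mu> A). 0 \<le> 1 + f w"
    using nn by (auto intro!: AE_I2)
  have "0 \<le> (\<integral>w. 1 - f w \<partial>positive_part M \<mu>)"
    "0 \<le> (\<integral>w. 1 + f w \<partial>positive_part M (\<lambda>A. - \<mu> A))"
    using integral_nonneg_AE[OF ae(1)] integral_nonneg_AE[OF ae(2)] by auto
  with tv_norm_minus_signed_integral[OF \<mu> f b] eq
  have "(\<integral>w. 1 - f w \<partial>positive_part M \<mu>) = 0"
    "(\<integral>w. 1 + f w \<partial>positive_part M (\<lambda>A. - \<mu> A)) = 0"
    by linarith+
  then have "AE w in positive_part M \<mu>. 1 - f w = 0"
    "AE w in positive_part M (\<lambda>A. - \<mu> A). 1 + f w = 0"
    using integral_nonneg_eq_0_iff_AE[OF int(1) ae(1)] integral_nonneg_eq_0_iff_AE[OF int(2) ae(2)]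
    by blast+
  then show "AE w in positive_part M \<mu>. f w = 1" "AE w in positive_part M (\<lambda>A. - \<mu> A). f w = - 1"
    by (auto elim!: eventually_mono)
qed

lemma AE_positive_part_finite_support:
  assumes \<mu>: "\<mu> \<in> signed_measures M" and F: "finite F" "\<And>w. w \<in> F \<Longrightarrow> {w} \<in> sets M"
    and null: "\<And>B. B \<in> sets M \<Longrightarrow> B \<inter> F = {} \<Longrightarrow> \<mu> B = 0"
  shows "AE w in positive_part M \<mu>. w \<in> F"
proof (rule AE_I[of _ _ "space M - F"])
  have FM: "F \<in> sets M"
    using sets.finite_UN[of F "\<lambda>w. {w}" M] F by simp
  then show "space M - F \<in> sets (positive_part M \<mu>)" by auto
  have "positive_variation M \<mu> (space M - F) \<le> 0"
    by (rule positive_variation_least, subst null) auto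
  then show "emeasure (positive_part M \<mu>) (space M - F) = 0"
    using FM by (simp add: emeasure_positive_part[OF \<mu>] ennreal_eq_0_iff)
qed auto

lemma integral_finite_support:
  fixes f :: "'a \<Rightarrow> real"
  assumes "finite_measure M" and F: "finite F" "\<And>w. w \<in> F \<Longrightarrow> {w} \<in> sets M"
    and ae: "AE w in M. w \<in> F" and f: "f \<in> borel_measurable M"
  shows "(\<integral>w. f w \<partial>M) = (\<Sum>w\<in>F. f w * measure M {w})"
proof -
  interpret finite_measure M by fact
  have "(\<integral>w. f w \<partial>M) = (\<integral>w. (\<Sum>v\<in>F. f v * indicator {v} w) \<partial>M)"
  proof (rule integral_cong_AE)
    show "AE w in M. f w = (\<Sum>v\<in>F. f v * indicator {v} w)"
      using ae
    proof eventually_elim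
      case (elim w)
      have "(\<Sum>v\<in>F. f v * indicator {v} w) = (\<Sum>v\<in>F. if v = w then f v else 0)"
        by (rule sum.cong) auto
      also have "\<dots> = f w" using elim F(1) by simp
      finally show ?case by simp
    qed
    show "(\<lambda>w. \<Sum>v\<in>F. f v * indicator {v} w) \<in> borel_measurable M"
      by (intro borel_measurable_sum borel_measurable_times borel_measurable_indicator) (use F in auto)
  qed (rule f)
  also have "\<dots> = (\<Sum>v\<in>F. \<integral>w. f v * indicator {v} w \<partial>M)"
    by (rule Bochner_Integration.integral_sum) (use F in \<open>auto simp: less_top[symmetric]\<close>)
  also have "\<dots> = (\<Sum>w\<in>F. f w * measure M {w})"
    using F sets.sets_into_space by (intro sum.cong) (auto simp: Int_absorb2)
  finally show ?thesis .
qed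

text \<open>Both Jordan parts inherit the finite support, and their atoms recombine by
  \<open>jordan_decomposition\<close>. The Jordan parts of a spike measure therefore need not be
  computed.\<close>

lemma signed_integral_finite_support:
  assumes \<mu>: "\<mu> \<in> signed_measures M" and F: "finite F" "\<And>w. w \<in> F \<Longrightarrow> {w} \<in> sets M"
    and null: "\<And>B. B \<in> sets M \<Longrightarrow> B \<inter> F = {} \<Longrightarrow> \<mu> B = 0"
    and f: "f \<in> borel_measurable M"
  shows "signed_integral M \<mu> f = (\<Sum>w\<in>F. f w * \<mu> {w})"
proof -
  note \<mu>' = signed_measures_uminus[OF \<mu>]
  have "(\<integral>w. f w \<partial>positive_part M \<mu>) = (\<Sum>w\<in>F. f w * measure (positive_part M \<mu>) {w})"
    by (rule integral_finite_support[OF finite_measure_positive_part[OF \<mu>] F(1) _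
        AE_positive_part_finite_support[OF \<mu> F null]]) (simp_all add: F f)
  moreover have "(\<integral>w. f w \<partial>positive_part M (\<lambda>A. - \<mu> A)) =
      (\<Sum>w\<in>F. f w * measure (positive_part M (\<lambda>A. - \<mu> A)) {w})"
    by (rule integral_finite_support[OF finite_measure_positive_part[OF \<mu>'] F(1) _
        AE_positive_part_finite_support[OF \<mu>' F]]) (simp_all add: F f null)
  moreover have "(\<Sum>w\<in>F. f w * \<mu> {w}) = (\<Sum>w\<in>F. f w * measure (positive_part M \<mu>) {w}) -
      (\<Sum>w\<in>F. f w * measure (positive_part M (\<lambda>A. - \<mu> A)) {w})"
    unfolding sum_subtractf[symmetric]
    by (rule sum.cong[OF refl], subst jordan_decomposition[OF \<mu> F(2)]) (auto simp: right_diff_distrib)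
  ultimately show ?thesis by (simp add: signed_integral_def)
qed

lemma signed_measures_eq_finite_support:
  assumes \<mu>: "\<mu> \<in> signed_measures M" and F: "finite F" "\<And>w. w \<in> F \<Longrightarrow> {w} \<in> sets M"
    and null: "\<And>B. B \<in> sets M \<Longrightarrow> B \<inter> F = {} \<Longrightarrow> \<mu> B = 0" and A: "A \<in> sets M"
  shows "\<mu> A = (\<Sum>w\<in>F \<inter> A. \<mu> {w})"
proof -
  have sub: "\<mu> G = (\<Sum>w\<in>G. \<mu> {w}) \<and> G \<in> sets M" if "finite G" "G \<subseteq> F" for G
    using that
  proof (induction G rule: finite_induct)
    case empty
    then show ?case by (simp add: signed_measures_empty[OF \<mu>])
  next
    case (insert w G)
    then have "\<mu> ({w} \<union> G) = \<mu> {w} + \<mu> G"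
      by (intro signed_measures_Un[OF \<mu>]) (use F in auto)
    moreover have "{w} \<union> G \<in> sets M" using insert F by (intro sets.Un) auto
    ultimately show ?case using insert by simp
  qed
  have G: "\<mu> (F \<inter> A) = (\<Sum>w\<in>F \<inter> A. \<mu> {w})" "F \<inter> A \<in> sets M"
    using sub[of "F \<inter> A"] F by auto
  have "\<mu> (A - F \<inter> A) = \<mu> A - \<mu> (F \<inter> A)"
    by (rule signed_measures_Diff[OF \<mu> A G(2)]) auto
  moreover have "\<mu> (A - F \<inter> A) = 0"
    by (rule null) (use A G(2) in auto)
  ultimately show ?thesis using G(1) by simp
qed

section \<open>Discrete measures on the sphere\<close>

lemma dirac_signed_measures: "dirac M w \<in> signed_measures M"
  unfolding signed_measures_def
proof (intro CollectI conjI allI impI)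
  fix A :: "nat \<Rightarrow> 'a set" assume A: "range A \<subseteq> sets M \<and> disjoint_family A"
  have AM: "A i \<in> sets M" for i using A by auto
  show "(\<lambda>i. dirac M w (A i)) sums dirac M w (\<Union>i. A i)"
  proof (cases "w \<in> (\<Union>i. A i)")
    case True
    then obtain k where k: "w \<in> A k" by auto
    have "w \<in> A i \<longleftrightarrow> i = k" for i
      using A k unfolding disjoint_family_on_def by blast
    then have "(\<lambda>i. dirac M w (A i)) = (\<lambda>i. if i = k then 1 else 0)"
      using AM by (auto simp: dirac_def)
    moreover have "dirac M w (\<Union>i. A i) = 1" using True AM by (auto simp: dirac_def)
    ultimately show ?thesis using sums_single[of k "\<lambda>_. 1::real"] by simp
  next
    case False
    then have "(\<lambda>i. dirac M w (A i)) = (\<lambda>i. 0)" "dirac M w (\<Union>i. A i) = 0"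
      by (auto simp: dirac_def)
    then show ?thesis by simp
  qed
qed (simp add: dirac_def)

lemma signed_measures_sum:
  assumes "\<And>i. i \<in> I \<Longrightarrow> \<mu> i \<in> signed_measures M"
  shows "(\<lambda>A. \<Sum>i\<in>I. a i * \<mu> i A) \<in> signed_measures M"
  using assms unfolding signed_measures_def
  by (auto intro!: sums_sum sums_mult)

lemma spike_measure_signed_measures: "spike_measure c s w \<in> signed_measures sphere_borel"
  unfolding spike_measure_def by (rule signed_measures_sum) (rule dirac_signed_measures)

lemma sphere_borel_singleton: "v \<in> unit_sphere \<Longrightarrow> {v} \<in> sets sphere_borel"
  unfolding sets_restrict_space by (rule image_eqI[of _ _ "{v}"]) auto

lemma signed_integral_spike_measure:
  assumes w: "\<And>i. w i \<in> unit_sphere" and f: "f \<in> borel_measurable sphere_borel"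
  shows "signed_integral sphere_borel (spike_measure c s w) f = (\<Sum>i\<in>UNIV. c i * s i * f (w i))"
proof -
  have single: "{w i} \<in> sets sphere_borel" for i using w by (rule sphere_borel_singleton)
  have "signed_integral sphere_borel (spike_measure c s w) f =
      (\<Sum>v\<in>range w. f v * spike_measure c s w {v})"
    by (rule signed_integral_finite_support[OF spike_measure_signed_measures _ _ _ f])
      (use single in \<open>auto simp: spike_measure_def dirac_def disjoint_iff intro!: sum.neutral\<close>)
  \<comment> \<open>The points need not be distinct: weights meeting at one point are collected in
    the inner sum, and exchanging the sums separates them again.\<close>
  also have "\<dots> = (\<Sum>v\<in>range w. \<Sum>i\<in>UNIV. if v = w i then c i * s i * f v else 0)"
    unfolding spike_measure_def sum_distrib_left
    using single by (intro sum.cong refl) (auto simp: dirac_def)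
  also have "\<dots> = (\<Sum>i\<in>UNIV. \<Sum>v\<in>range w. if v = w i then c i * s i * f v else 0)"
    by (rule sum.swap)
  also have "\<dots> = (\<Sum>i\<in>UNIV. c i * s i * f (w i))"
    by (intro sum.cong refl) simp
  finally show ?thesis .
qed

lemma tv_norm_spike_measure_le:
  fixes w :: "'i::finite \<Rightarrow> real^'d"
  shows "tv_norm sphere_borel (spike_measure c s w) \<le> (\<Sum>i\<in>UNIV. \<bar>c i * s i\<bar>)"
  unfolding tv_norm_def
proof (rule cSUP_least)
  let ?S = "space (sphere_borel :: (real^'d) measure)"
  have "?S \<noteq> {}" by (simp add: space_restrict_space)
  then have "{?S} \<in> {P. finite P \<and> partition_on ?S P \<and> P \<subseteq> sets sphere_borel}"
    using sets.top[of "sphere_borel :: (real^'d) measure"]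
    by (simp add: partition_on_def eq_commute[of "{}"])
  then show "{P. finite P \<and> partition_on ?S P \<and> P \<subseteq> sets sphere_borel} \<noteq> {}" by blast
next
  fix P :: "(real^'d) set set"
  assume "P \<in> {P. finite P \<and> partition_on (space sphere_borel) P \<and> P \<subseteq> sets sphere_borel}"
  then have P: "finite P" "disjoint P" by (auto simp: partition_on_def)
  have "(\<Sum>A\<in>P. \<bar>spike_measure c s w A\<bar>) \<le>
      (\<Sum>A\<in>P. \<Sum>i\<in>UNIV. \<bar>c i * s i\<bar> * dirac sphere_borel (w i) A)"
    unfolding spike_measure_def
    by (intro sum_mono order_trans[OF sum_abs]) (auto simp: abs_mult dirac_def)
  also have "\<dots> = (\<Sum>i\<in>UNIV. \<bar>c i * s i\<bar> * (\<Sum>A\<in>P. dirac sphere_borel (w i) A))"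
    by (subst sum.swap) (simp add: sum_distrib_left)
  also have "\<dots> \<le> (\<Sum>i\<in>UNIV. \<bar>c i * s i\<bar> * 1)"
  proof (intro sum_mono mult_left_mono)
    fix i
    have "(\<Sum>A\<in>P. dirac sphere_borel (w i) A) \<le> (\<Sum>A\<in>P. of_bool (w i \<in> A))"
      by (intro sum_mono) (simp add: dirac_def)
    also have "\<dots> = card {A \<in> P. w i \<in> A}"
      using P(1) by (simp add: Int_def)
    \<comment> \<open>The blocks are disjoint, so at most one of them contains
      \<open>w i\<close>.\<close>
    also have "\<dots> \<le> 1"
      using P by (auto simp: card_le_Suc0_iff_eq disjoint_def)
    finally show "(\<Sum>A\<in>P. dirac sphere_borel (w i) A) \<le> 1" by simp
  qed auto
  finally show "(\<Sum>A\<in>P. \<bar>spike_measure c s w A\<bar>) \<le> (\<Sum>i\<in>UNIV. \<bar>c i * s i\<bar>)" by simp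
qed

text \<open>The lower bound tests the measure against a function with the value
  \<open>sgn (c i * s i)\<close> at \<open>w i\<close>. Injectivity makes this well defined and
  prevents cancellation between spikes. A measurable test function is enough, so no continuous
  interpolation is needed.\<close>

lemma tv_norm_spike_measure:
  fixes w :: "'i::finite \<Rightarrow> real^'d"
  assumes w: "\<And>i. w i \<in> unit_sphere" and inj: "inj w"
  shows "tv_norm sphere_borel (spike_measure c s w) = (\<Sum>i\<in>UNIV. \<bar>c i * s i\<bar>)"
proof (rule antisym[OF tv_norm_spike_measure_le])
  have single: "{w i} \<in> sets sphere_borel" for i using w by (rule sphere_borel_singleton)
  define f where "f v = (\<Sum>i\<in>UNIV. sgn (c i * s i) * indicator {w i} v)" for v
  have f: "f \<in> borel_measurable sphere_borel"
    unfolding f_def[abs_def]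
    by (intro borel_measurable_sum borel_measurable_times borel_measurable_indicator single) auto
  have f_at: "f (w k) = sgn (c k * s k)" for k
  proof -
    have "f (w k) = (\<Sum>i\<in>UNIV. if i = k then sgn (c i * s i) else 0)"
      unfolding f_def using inj by (intro sum.cong) (auto simp: indicator_def dest: injD)
    then show ?thesis by simp
  qed
  have "\<bar>f v\<bar> \<le> 1" for v
  proof (cases "v \<in> range w")
    case True
    then show ?thesis using f_at by (auto simp: sgn_if)
  next
    case False
    then have "f v = 0" unfolding f_def by (intro sum.neutral) (auto simp: indicator_def)
    then show ?thesis by simp
  qed
  from signed_integral_le_tv_norm[OF spike_measure_signed_measures[of c s w] f this]
  have "(\<Sum>i\<in>UNIV. c i * s i * f (w i)) \<le> tv_norm sphere_borel (spike_measure c s w)"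
    by (simp add: signed_integral_spike_measure[OF w f])
  moreover have "c i * s i * f (w i) = \<bar>c i * s i\<bar>" for i
    by (simp only: f_at abs_sgn)
  ultimately show "(\<Sum>i\<in>UNIV. \<bar>c i * s i\<bar>) \<le> tv_norm sphere_borel (spike_measure c s w)"
    by simp
qed

text \<open>Equality in the duality inequality concentrates both Jordan parts on the points where
  \<open>\<bar>f\<bar>\<close> is 1, that is, inside the finite set \<open>range w\<close>. The
  weights obtained in this way may have any sign.\<close>

lemma saturated_imp_spike_measure:
  fixes w :: "'i::finite \<Rightarrow> real^'d"
  assumes \<nu>: "\<nu> \<in> signed_measures sphere_borel" and f: "f \<in> borel_measurable sphere_borel"
    and b: "\<And>v. v \<in> unit_sphere \<Longrightarrow> \<bar>f v\<bar> \<le> 1"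
    and eq: "signed_integral sphere_borel \<nu> f = tv_norm sphere_borel \<nu>"
    and w: "\<And>i. w i \<in> unit_sphere" and inj: "inj w"
    and sat: "\<And>v. v \<in> unit_sphere \<Longrightarrow> \<bar>f v\<bar> = 1 \<Longrightarrow> v \<in> range w"
    and s: "\<And>i. s i \<noteq> 0"
  shows "\<exists>c. \<nu> = spike_measure c s w"
proof -
  let ?M = "sphere_borel :: (real^'d) measure"
  have sp: "space ?M = unit_sphere" by (simp add: space_restrict_space)
  have single: "{w i} \<in> sets ?M" for i using w by (rule sphere_borel_singleton)
  have ae: "AE v in positive_part ?M \<nu>. f v = 1" "AE v in positive_part ?M (\<lambda>A. - \<nu> A). f v = - 1"
    using AE_positive_part_saturated[OF \<nu> f _ eq] b sp by auto
  have null: "\<nu> B = 0" if B: "B \<in> sets ?M" "B \<inter> range w = {}" for B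
  proof -
    have BS: "B \<subseteq> unit_sphere" using sets.sets_into_space[OF B(1)] sp by simp
    \<comment> \<open>Stated for a general measure \<open>N\<close> so that it applies to both
      Jordan parts.\<close>
    have B0: "measure N B = 0" if N: "AE v in N. f v \<in> {-1, 1}" "sets N = sets ?M" for N
    proof -
      have "AE v in N. v \<notin> B"
        using N(1) by eventually_elim (use B(2) BS sat in fastforce)
      then have "emeasure N {v \<in> space N. v \<in> B} = 0" by (rule emeasure_eq_0_AE)
      moreover have "{v \<in> space N. v \<in> B} = B"
        using sets_eq_imp_space_eq[OF N(2)] BS sp by auto
      ultimately show ?thesis by (simp add: measure_def)
    qed
    have "measure (positive_part ?M \<nu>) B = 0"
      by (rule B0) (use ae(1) in \<open>auto elim: eventually_mono\<close>)
    moreover have "measure (positive_part ?M (\<lambda>A. - \<nu> A)) B = 0"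
      by (rule B0) (use ae(2) in \<open>auto elim: eventually_mono\<close>)
    ultimately show ?thesis using jordan_decomposition[OF \<nu> B(1)] by simp
  qed
  \<comment> \<open>The atom at \<open>w i\<close> is divided by \<open>s i\<close> because
    \<open>spike_measure\<close> multiplies it back.\<close>
  have "\<nu> A = spike_measure (\<lambda>i. \<nu> {w i} / s i) s w A" for A
  proof (cases "A \<in> sets ?M")
    case True
    have "\<nu> A = (\<Sum>v\<in>range w \<inter> A. \<nu> {v})"
      by (rule signed_measures_eq_finite_support[OF \<nu> _ _ null True]) (use single in auto)
    also have "range w \<inter> A = w ` {i. w i \<in> A}" by auto
    also have "(\<Sum>v\<in>\<dots>. \<nu> {v}) = (\<Sum>i | w i \<in> A. \<nu> {w i})"
      using inj by (subst sum.reindex) (auto intro: inj_on_subset)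
    also have "\<dots> = (\<Sum>i\<in>UNIV. if w i \<in> A then \<nu> {w i} else 0)"
      by (simp add: sum.If_cases)
    also have "\<dots> = spike_measure (\<lambda>i. \<nu> {w i} / s i) s w A"
      unfolding spike_measure_def using s True by (intro sum.cong) (auto simp: dirac_def)
    finally show ?thesis .
  next
    case False
    then show ?thesis by (simp add: signed_measures_outside[OF \<nu>] spike_measure_def dirac_def)
  qed
  then show ?thesis by blast
qed

section \<open>The network operators\<close>

lemma borel_measurable_sphere_borel:
  "continuous_on UNIV f \<Longrightarrow> f \<in> borel_measurable sphere_borel"
  by (intro measurable_restrict_space1 borel_measurable_continuous_onI)

lemma continuous_on_relu_inner: "continuous_on S (\<lambda>w. relu (w \<bullet> x))"
  unfolding relu_def by (intro continuous_intros)

lemma continuous_on_K_adj: "continuous_on S (K_adj x p)"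
  unfolding K_adj_def[abs_def] by (intro continuous_intros continuous_on_relu_inner)

lemmas borel_measurable_relu_inner = borel_measurable_sphere_borel[OF continuous_on_relu_inner]
lemmas borel_measurable_K_adj = borel_measurable_sphere_borel[OF continuous_on_K_adj]

lemma abs_relu_inner_le: "w \<in> unit_sphere \<Longrightarrow> \<bar>relu (w \<bullet> x)\<bar> \<le> norm x"
  using norm_cauchy_schwarz[of w x] by (auto simp: relu_def)

lemma inner_K_op:
  assumes \<nu>: "\<nu> \<in> signed_measures sphere_borel"
  shows "p \<bullet> K_op x \<nu> = signed_integral sphere_borel \<nu> (K_adj x p)"
proof -
  have "signed_integral sphere_borel \<nu> (\<lambda>w. \<Sum>j\<in>UNIV. p $ j * relu (w \<bullet> x j)) =
      (\<Sum>j\<in>UNIV. p $ j * signed_integral sphere_borel \<nu> (\<lambda>w. relu (w \<bullet> x j)))"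
    by (rule signed_integral_sum[OF \<nu>, where b = "\<lambda>j. norm (x j)"])
      (auto simp: borel_measurable_relu_inner space_restrict_space abs_relu_inner_le)
  then show ?thesis
    by (simp add: K_op_def K_adj_def[abs_def] inner_vec_def)
qed

lemma inner_K_op_le_tv_norm:
  assumes "\<nu> \<in> signed_measures sphere_borel" and "p \<in> dual_feasible x"
  shows "p \<bullet> K_op x \<nu> \<le> tv_norm sphere_borel \<nu>"
  unfolding inner_K_op[OF assms(1)]
  by (rule signed_integral_le_tv_norm[OF assms(1) borel_measurable_K_adj])
    (use assms(2) in \<open>auto simp: dual_feasible_def sphere_sup_norm_le_iff space_restrict_space\<close>)

lemma K_op_spike_measure:
  assumes "\<And>i. w i \<in> unit_sphere"
  shows "K_op x (spike_measure c s w) = (\<chi> j. \<Sum>i\<in>UNIV. c i * s i * relu (w i \<bullet> x j))"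
  unfolding K_op_def by (simp add: signed_integral_spike_measure[OF assms borel_measurable_relu_inner])

section \<open>Optimality from a dual certificate\<close>

text \<open>Inserting \<open>y = K_op x \<mu> + lam *\<^sub>R p\<close>, the objective at
  \<open>q\<close> exceeds that at \<open>p\<close> by \<open>(q - p) \<bullet> K_op x \<mu>\<close>
  minus \<open>lam / 2\<close> times the squared distance. The inner product is nonpositive, because
  \<open>p\<close> attains the total variation norm of \<open>\<mu>\<close>.\<close>

lemma tv_norm_eq_imp_dual_optimal:
  assumes lam: "lam > 0" and \<mu>: "\<mu> \<in> signed_measures sphere_borel"
    and p: "p \<in> dual_feasible x" and res: "K_op x \<mu> = y - lam *\<^sub>R p"
    and tv: "p \<bullet> K_op x \<mu> = tv_norm sphere_borel \<mu>"
  shows "training_dual_solution x lam y = p"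
proof -
  have "training_dual_objective lam y q \<le> training_dual_objective lam y p"
    if q: "q \<in> dual_feasible x" for q
  proof -
    have y: "y = K_op x \<mu> + lam *\<^sub>R p" using res by simp
    have "q \<bullet> K_op x \<mu> \<le> p \<bullet> K_op x \<mu>"
      using inner_K_op_le_tv_norm[OF \<mu> q] tv by simp
    moreover have "0 \<le> lam / 2 * (norm (q - p))\<^sup>2" using lam by simp
    ultimately show ?thesis
      unfolding training_dual_objective_def y power2_norm_eq_inner
      by (simp add: inner_diff_left inner_diff_right inner_add_left inner_commute algebra_simps)
  qed
  then have "is_arg_max (training_dual_objective lam y) (\<lambda>p. p \<in> dual_feasible x) p"
    using p by (auto simp: is_arg_max_def not_less)
  then show ?thesis by (simp add: training_dual_solution_iff[OF lam])
qed

text \<open>Expanding the square around \<open>K_op x \<mu>\<close> writes the excess of the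
  objective at \<open>\<nu>\<close> as a squared residual difference plus \<open>lam\<close> times
  the duality gap of \<open>\<nu>\<close>. Both terms are nonnegative, so a minimiser makes both
  vanish.\<close>

lemma training_solution_iff:
  assumes lam: "lam > 0" and \<mu>: "\<mu> \<in> signed_measures sphere_borel"
    and p: "p \<in> dual_feasible x" and res: "K_op x \<mu> = y - lam *\<^sub>R p"
    and tv: "p \<bullet> K_op x \<mu> = tv_norm sphere_borel \<mu>"
  shows "training_solution x lam y \<nu> \<longleftrightarrow>
    \<nu> \<in> signed_measures sphere_borel \<and> K_op x \<nu> = K_op x \<mu> \<and> p \<bullet> K_op x \<nu> = tv_norm sphere_borel \<nu>"
proof -
  define J where "J \<nu> = 1 / 2 * (norm (K_op x \<nu> - y))\<^sup>2 + lam * tv_norm sphere_borel \<nu>" for \<nu>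
  have y: "y = K_op x \<mu> + lam *\<^sub>R p" using res by simp
  have J: "J \<nu> = J \<mu> + 1 / 2 * (norm (K_op x \<nu> - K_op x \<mu>))\<^sup>2 +
      lam * (tv_norm sphere_borel \<nu> - p \<bullet> K_op x \<nu>)" for \<nu>
    unfolding J_def tv[symmetric] y power2_norm_eq_inner
    by (simp add: inner_diff_left inner_diff_right inner_add_left inner_add_right inner_commute
        algebra_simps)
  have ge: "0 \<le> lam * (tv_norm sphere_borel \<nu> - p \<bullet> K_op x \<nu>)"
    if "\<nu> \<in> signed_measures sphere_borel" for \<nu>
    using inner_K_op_le_tv_norm[OF that p] lam by simp
  have le: "J \<mu> \<le> J \<nu>" if "\<nu> \<in> signed_measures sphere_borel" for \<nu>
    using ge[OF that] J[of \<nu>] zero_le_power2[of "norm (K_op x \<nu> - K_op x \<mu>)"] by linarith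
  have "training_solution x lam y \<nu> \<longleftrightarrow> \<nu> \<in> signed_measures sphere_borel \<and> J \<nu> \<le> J \<mu>"
    unfolding training_solution_def is_arg_min_def J_def[symmetric]
    using le \<mu> by (meson not_less order_trans)
  also have "\<dots> \<longleftrightarrow> \<nu> \<in> signed_measures sphere_borel \<and> K_op x \<nu> = K_op x \<mu> \<and>
      p \<bullet> K_op x \<nu> = tv_norm sphere_borel \<nu>"
  proof (intro conj_cong refl)
    assume "\<nu> \<in> signed_measures sphere_borel"
    note ge = ge[OF this]
    show "J \<nu> \<le> J \<mu> \<longleftrightarrow> K_op x \<nu> = K_op x \<mu> \<and> p \<bullet> K_op x \<nu> = tv_norm sphere_borel \<nu>"
    proof
      assume "J \<nu> \<le> J \<mu>"
      then have "(norm (K_op x \<nu> - K_op x \<mu>))\<^sup>2 = 0"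
        "lam * (tv_norm sphere_borel \<nu> - p \<bullet> K_op x \<nu>) = 0"
        using J[of \<nu>] ge zero_le_power2[of "norm (K_op x \<nu> - K_op x \<mu>)"] by linarith+
      then show "K_op x \<nu> = K_op x \<mu> \<and> p \<bullet> K_op x \<nu> = tv_norm sphere_borel \<nu>"
        using lam by simp
    next
      assume "K_op x \<nu> = K_op x \<mu> \<and> p \<bullet> K_op x \<nu> = tv_norm sphere_borel \<nu>"
      then have "K_op x \<nu> = K_op x \<mu>" "tv_norm sphere_borel \<nu> = p \<bullet> K_op x \<nu>" by metis+
      then show "J \<nu> \<le> J \<mu>" by (simp add: J[of \<nu>])
    qed
  qed
  finally show ?thesis .
qed

section \<open>Linearisation on the dual regions\<close>

text \<open>The operator \<open>A\<close> of the overview: component \<open>i\<close> is the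
  gradient of \<open>K_adj x p\<close> on the region with pattern \<open>\<pi> i\<close>.\<close>

definition region_map ::
  "('n::finite \<Rightarrow> real^'d) \<Rightarrow> ('N::finite \<Rightarrow> 'n \<Rightarrow> bool) \<Rightarrow> real^'n \<Rightarrow> real^'d^'N" where
  "region_map x \<pi> p = (\<chi> i. \<Sum>j\<in>UNIV. if \<pi> i j then p $ j *\<^sub>R x j else 0)"

text \<open>The adjoint of \<open>region_map\<close> (see \<open>inner_region_adj\<close>). It is
  defined for all vectors, inside the regions or not, which makes it linear on the whole space; on
  spikes lying in their regions it agrees with \<open>K_op\<close>.\<close>

definition region_adj ::
  "('n::finite \<Rightarrow> real^'d) \<Rightarrow> ('N::finite \<Rightarrow> 'n \<Rightarrow> bool) \<Rightarrow> real^'d^'N \<Rightarrow> real^'n" where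
  "region_adj x \<pi> v = (\<chi> j. \<Sum>i\<in>UNIV. if \<pi> i j then v $ i \<bullet> x j else 0)"

lemma linear_region_map: "linear (region_map x \<pi>)"
  by (rule linearI)
    (auto simp: region_map_def vec_eq_iff scaleR_add_left sum_distrib_left
      simp flip: sum.distrib intro!: sum.cong)

lemma linear_region_adj: "linear (region_adj x \<pi>)"
  by (rule linearI)
    (auto simp: region_adj_def vec_eq_iff inner_add_left sum_distrib_left
      simp flip: sum.distrib intro!: sum.cong)

lemma inner_region_adj: "p \<bullet> region_adj x \<pi> v = region_map x \<pi> p \<bullet> v"
proof -
  have "p \<bullet> region_adj x \<pi> v = (\<Sum>j\<in>UNIV. \<Sum>i\<in>UNIV. if \<pi> i j then p $ j * (v $ i \<bullet> x j) else 0)"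
    unfolding region_adj_def inner_vec_def[of p]
    by (auto simp: sum_distrib_left intro!: sum.cong)
  also have "\<dots> = (\<Sum>i\<in>UNIV. \<Sum>j\<in>UNIV. if \<pi> i j then p $ j * (v $ i \<bullet> x j) else 0)"
    by (rule sum.swap)
  also have "\<dots> = (\<Sum>i\<in>UNIV. region_map x \<pi> p $ i \<bullet> v $ i)"
    unfolding region_map_def vec_lambda_beta inner_sum_left
    by (auto simp: inner_commute intro!: sum.cong)
  also have "\<dots> = region_map x \<pi> p \<bullet> v" by (rule inner_vec_def[symmetric])
  finally show ?thesis .
qed

lemma relu_dual_region:
  "w \<in> dual_region x \<pi> \<Longrightarrow> relu (w \<bullet> x j) = (if \<pi> j then w \<bullet> x j else 0)"
  by (auto simp: dual_region_def relu_def max_def dest: spec[of _ j])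

lemma K_adj_dual_region:
  assumes "w \<in> dual_region x (\<pi> i)"
  shows "K_adj x p w = region_map x \<pi> p $ i \<bullet> w"
  unfolding K_adj_def region_map_def vec_lambda_beta inner_sum_left
  by (auto simp: relu_dual_region[OF assms] inner_commute intro!: sum.cong)

lemma K_op_spike_measure_dual_region:
  assumes "\<And>i. w i \<in> dual_region x (\<pi> i) \<inter> unit_sphere"
  shows "K_op x (spike_measure c s w) = region_adj x \<pi> (\<chi> i. (c i * s i) *\<^sub>R w i)"
proof -
  have "w i \<in> unit_sphere" and r: "w i \<in> dual_region x (\<pi> i)" for i using assms by auto
  then show ?thesis
    by (auto simp: K_op_spike_measure region_adj_def relu_dual_region[OF r] vec_eq_iff
        intro!: sum.cong)
qed

lemma open_dual_region: "open (dual_region x \<pi>)"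
proof -
  have "dual_region x \<pi> = (\<Inter>j. if \<pi> j then {w. 0 < w \<bullet> x j} else {w. w \<bullet> x j < 0})"
    by (auto simp: dual_region_def split: if_splits)
  moreover have "open {w. 0 < w \<bullet> x j}" "open {w. w \<bullet> x j < 0}" for j
    by (intro open_Collect_less continuous_intros)+
  ultimately show ?thesis by (auto intro!: open_INT)
qed

lemma dual_region_pattern_unique:
  assumes "w \<in> dual_region x \<pi>" "w \<in> dual_region x \<pi>'"
  shows "\<pi> = \<pi>'"
proof
  fix j show "\<pi> j = \<pi>' j"
    using assms unfolding dual_region_def by (cases "\<pi> j"; cases "\<pi>' j") force+
qed

text \<open>A single data index decides, and \<open>undefined\<close> serves as an arbitrary one.
  The fact excludes the antipode in the equality case of Cauchy-Schwarz.\<close>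

lemma uminus_notin_dual_region:
  assumes "w \<in> dual_region x \<pi>"
  shows "- w \<notin> dual_region x \<pi>"
  using assms unfolding dual_region_def by (cases "\<pi> undefined") force+

text \<open>On a dual region the network function is linear, so its value and its spherical gradient at
  a point of the region together carry the same information as its coefficient vector.\<close>

lemma surj_region_map:
  fixes x :: "'n::finite \<Rightarrow> real^'d" and w :: "'N::finite \<Rightarrow> real^'d"
  assumes w: "\<And>i. w i \<in> dual_region x (\<pi> i) \<inter> unit_sphere"
    and rank: "dim (range (\<lambda>p. (K_mat x w *v p, K_deriv x w p))) = CARD('N) * CARD('d)"
  shows "surj (region_map x \<pi>)"
proof -
  \<comment> \<open>\<open>T\<close> splits each coefficient vector into its component along
    \<open>w i\<close> and its tangential remainder. These are the value and the spherical gradient,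
    so the stacked operator factors as \<open>T\<close> after \<open>region_map\<close>.\<close>
  define T :: "real^'d^'N \<Rightarrow> (real^'N) \<times> (real^'d^'N)"
    where "T a = (\<chi> i. a $ i \<bullet> w i, \<chi> i. a $ i - (a $ i \<bullet> w i) *\<^sub>R w i)" for a
  have T: "linear T"
    by (rule linearI) (auto simp: T_def vec_eq_iff inner_add_left algebra_simps)
  have "(K_mat x w *v p, K_deriv x w p) = T (region_map x \<pi> p)" for p
  proof -
    have wi: "w i \<in> dual_region x (\<pi> i)" "w i \<in> unit_sphere" for i using w by auto
    have "K_mat x w *v p = (\<chi> i. region_map x \<pi> p $ i \<bullet> w i)"
      unfolding K_adj_dual_region[of _ x \<pi>, OF wi(1), symmetric]
      by (simp add: vec_eq_iff K_mat_def matrix_vector_mult_def K_adj_def mult.commute)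
    moreover have "K_deriv x w p = (\<chi> i. region_map x \<pi> p $ i - (region_map x \<pi> p $ i \<bullet> w i) *\<^sub>R w i)"
    proof -
      have grad: "sphere_grad (\<lambda>v. relu (v \<bullet> x j)) (w i) =
          (if \<pi> i j then x j - (x j \<bullet> w i) *\<^sub>R w i else 0)" for i j
      proof -
        have "w i \<bullet> x j \<noteq> 0" "\<pi> i j \<longleftrightarrow> w i \<bullet> x j > 0"
          using wi(1)[of i] unfolding dual_region_def by (cases "\<pi> i j"; force)+
        then show ?thesis by (simp add: sphere_grad_relu[OF wi(2)] inner_commute)
      qed
      show ?thesis
        unfolding K_deriv_def region_map_def grad
        by (auto simp: vec_eq_iff inner_sum_left sum_distrib_right sum_distrib_left algebra_simps
            simp flip: sum_subtractf intro!: sum.cong)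
    qed
    ultimately show ?thesis by (simp add: T_def)
  qed
  then have "range (\<lambda>p. (K_mat x w *v p, K_deriv x w p)) = T ` range (region_map x \<pi>)" by auto
  \<comment> \<open>A linear image cannot gain dimension, so the full rank of the composite passes
    to the inner factor.\<close>
  then have "DIM(real^'d^'N) \<le> dim (range (region_map x \<pi>))"
    using rank dim_image_le[OF T, of "range (region_map x \<pi>)"] by simp
  then have "span (range (region_map x \<pi>)) = UNIV"
    using dim_subset_UNIV[of "range (region_map x \<pi>)"] by (metis dim_eq_full antisym)
  then show ?thesis
    by (simp add: span_eq_iff[THEN iffD2, OF linear_subspace_image[OF linear_region_map subspace_UNIV]])
qed

text \<open>Equal patterns give equal components of \<open>region_map\<close>, which surjectivity
  forbids. Hence no two spikes share a region, and in particular they are distinct.\<close>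

lemma surj_region_map_imp_inj:
  fixes x :: "'n::finite \<Rightarrow> real^'d" and \<pi> :: "'N::finite \<Rightarrow> 'n \<Rightarrow> bool"
  assumes surj: "surj (region_map x \<pi>)"
  shows "inj \<pi>"
proof (rule injI, rule ccontr)
  fix i k assume eq: "\<pi> i = \<pi> k" and ne: "i \<noteq> k"
  obtain p where p: "region_map x \<pi> p = (\<chi> l. if l = i then axis undefined 1 else 0)"
    using surj by (metis surjD)
  have "region_map x \<pi> p $ i = region_map x \<pi> p $ k" by (simp add: region_map_def eq)
  then show False using ne by (simp add: p axis_eq_0_iff)
qed

lemma inj_dual_region_points:
  assumes "inj \<pi>" and "\<And>i. w i \<in> dual_region x (\<pi> i)"
  shows "inj w"
  by (rule injI) (use assms dual_region_pattern_unique in \<open>metis injD\<close>)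

lemma inj_region_adj:
  assumes "surj (region_map x \<pi>)"
  shows "inj (region_adj x \<pi>)"
proof (rule linear_injective_0[OF linear_region_adj, THEN iffD2], intro allI impI)
  fix v assume v: "region_adj x \<pi> v = 0"
  obtain p where "region_map x \<pi> p = v" using assms by (metis surjD)
  then have "v \<bullet> v = p \<bullet> region_adj x \<pi> v" by (simp add: inner_region_adj)
  with v show "v = 0" by simp
qed

text \<open>A first-order condition on the sphere, obtained by comparing with the normalised point
  \<open>sgn (w + t *\<^sub>R b)\<close> for one small \<open>t\<close>. This yields
  \<open>b \<bullet> b \<le> 1\<close>, and together with \<open>b \<bullet> w = 1\<close> the
  squared distance of \<open>b\<close> and \<open>w\<close> is at most 0.\<close>

lemma dual_region_le_imp_eq:
  fixes b w :: "'a::real_inner"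
  assumes w: "w \<in> unit_sphere" and U: "open U" "w \<in> U" and bw: "b \<bullet> w = 1"
    and le: "\<And>v. v \<in> U \<inter> unit_sphere \<Longrightarrow> b \<bullet> v \<le> 1"
  shows "b = w"
proof -
  have ww: "w \<bullet> w = 1" using w by (simp flip: power2_norm_eq_inner)
  have "((\<lambda>t. sgn (w + t *\<^sub>R b)) \<longlongrightarrow> sgn (w + 0 *\<^sub>R b)) (at_right 0)"
    by (intro tendsto_intros) (use w in auto)
  moreover have "sgn (w + 0 *\<^sub>R b) = w" using w by (simp add: sgn_div_norm)
  ultimately have "\<forall>\<^sub>F t in at_right 0. sgn (w + t *\<^sub>R b) \<in> U"
    using U by (simp add: topological_tendstoD)
  moreover have "\<forall>\<^sub>F t in at_right (0::real). 0 < t" by (simp add: eventually_at_right_less)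
  ultimately have "\<forall>\<^sub>F t in at_right 0. 0 < t \<and> sgn (w + t *\<^sub>R b) \<in> U"
    by (rule eventually_elim2) auto
  then obtain t where t: "0 < t" "sgn (w + t *\<^sub>R b) \<in> U"
    using eventually_happens[of _ "at_right (0::real)"] by auto
  have "(w + t *\<^sub>R b) \<bullet> w = 1 + t" by (simp add: inner_add_left ww bw)
  then have ne: "w + t *\<^sub>R b \<noteq> 0" using t by auto
  then have "b \<bullet> sgn (w + t *\<^sub>R b) \<le> 1" using t by (intro le) (auto simp: norm_sgn)
  moreover have "b \<bullet> sgn u = (b \<bullet> u) / norm u" for u
    by (simp add: sgn_div_norm divide_inverse)
  ultimately have "b \<bullet> (w + t *\<^sub>R b) \<le> norm (w + t *\<^sub>R b)"
    using ne by (simp add: divide_le_eq_1)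
  moreover have bb: "b \<bullet> (w + t *\<^sub>R b) = 1 + t * (b \<bullet> b)" by (simp add: inner_add_right bw)
  ultimately have "(1 + t * (b \<bullet> b))\<^sup>2 \<le> (norm (w + t *\<^sub>R b))\<^sup>2"
    using t by (intro power_mono) (auto simp: add_nonneg_nonneg)
  also have "\<dots> = 1 + 2 * t + t\<^sup>2 * (b \<bullet> b)"
    unfolding power2_norm_eq_inner
    by (simp add: inner_add_left inner_add_right ww bw inner_commute[of w b] power2_eq_square
        distrib_left)
  \<comment> \<open>After subtraction the two squares factor, and \<open>b \<bullet> b - 1\<close>
    is the only factor whose sign is open.\<close>
  finally have "t * ((2 + t * (b \<bullet> b)) * (b \<bullet> b - 1)) \<le> 0"
    by (simp add: power2_eq_square algebra_simps)
  then have "(2 + t * (b \<bullet> b)) * (b \<bullet> b - 1) \<le> 0"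
    using t by (simp add: mult_le_0_iff)
  moreover have "0 < 2 + t * (b \<bullet> b)" using t by (simp add: add_pos_nonneg)
  ultimately have "b \<bullet> b \<le> 1" by (simp add: mult_le_0_iff)
  moreover have "(b - w) \<bullet> (b - w) = b \<bullet> b - 1"
    by (simp add: inner_diff_left inner_diff_right ww bw inner_commute[of w b])
  ultimately have "(b - w) \<bullet> (b - w) \<le> 0" by simp
  then show ?thesis by (simp flip: power2_norm_eq_inner)
qed

section \<open>Perturbation of the certificate\<close>

lemma abs_K_adj_le:
  assumes "w \<in> unit_sphere"
  shows "\<bar>K_adj x p w\<bar> \<le> norm p * (\<Sum>j\<in>UNIV. norm (x j))"
  unfolding K_adj_def sum_distrib_left
proof (intro order_trans[OF sum_abs] sum_mono)
  fix j show "\<bar>p $ j * relu (w \<bullet> x j)\<bar> \<le> norm p * norm (x j)"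
    unfolding abs_mult by (intro mult_mono component_le_norm_cart abs_relu_inner_le assms) auto
qed

lemma K_adj_diff: "K_adj x (p - q) w = K_adj x p w - K_adj x q w"
  by (simp add: K_adj_def left_diff_distrib sum_subtractf)

text \<open>The sphere without the open regions is compact and contains no \<open>w i\<close>, so
  the strict bound holds there with a uniform margin. \<open>K_adj\<close> is Lipschitz in its
  coefficient vector uniformly on the sphere, and small changes do not use up the margin.\<close>

lemma nonsaturated_perturbation:
  fixes x :: "'n::finite \<Rightarrow> real^'d" and w :: "'N::finite \<Rightarrow> real^'d"
  assumes w: "\<And>i. w i \<in> dual_region x (\<pi> i)"
    and ns: "\<And>v. v \<in> unit_sphere - range w \<Longrightarrow> \<bar>K_adj x p v\<bar> < 1"
  shows "\<exists>\<delta>>0. \<forall>q. norm (q - p) < \<delta> \<longrightarrow>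
    (\<forall>v\<in>unit_sphere - (\<Union>i. dual_region x (\<pi> i)). \<bar>K_adj x q v\<bar> < 1)"
proof -
  let ?S = "unit_sphere - (\<Union>i. dual_region x (\<pi> i))"
  have S: "compact ?S" by (intro compact_diff open_UN) (auto simp: open_dual_region)
  have lt: "\<bar>K_adj x p v\<bar> < 1" if "v \<in> ?S" for v using that w by (intro ns) auto
  obtain M where M: "M < 1" "\<And>v. v \<in> ?S \<Longrightarrow> \<bar>K_adj x p v\<bar> \<le> M"
  proof (cases "?S = {}")
    case True
    show ?thesis by (rule that[of 0]) (use True in auto)
  next
    case False
    then obtain u where "u \<in> ?S" "\<And>v. v \<in> ?S \<Longrightarrow> \<bar>K_adj x p v\<bar> \<le> \<bar>K_adj x p u\<bar>"
      using continuous_attains_sup[OF S, of "\<lambda>v. \<bar>K_adj x p v\<bar>"]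
      by (metis continuous_on_K_adj continuous_on_rabs)
    then show ?thesis using lt that by blast
  qed
  \<comment> \<open>Adding 1 keeps the divisor positive whatever the data are.\<close>
  let ?L = "1 + (\<Sum>j\<in>UNIV. norm (x j))"
  have L: "0 < ?L" by (simp add: add_pos_nonneg sum_nonneg)
  show ?thesis
  proof (intro exI conjI allI impI ballI)
    show "0 < (1 - M) / ?L" using M L by simp
    fix q v assume q: "norm (q - p) < (1 - M) / ?L" and v: "v \<in> ?S"
    have "\<bar>K_adj x q v - K_adj x p v\<bar> \<le> norm (q - p) * (\<Sum>j\<in>UNIV. norm (x j))"
      using abs_K_adj_le[of v x "q - p"] v by (simp add: K_adj_diff)
    also have "\<dots> \<le> norm (q - p) * ?L" by (intro mult_left_mono) auto
    also have "\<dots> < 1 - M" using q L by (simp add: field_simps)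
    finally show "\<bar>K_adj x q v\<bar> < 1" using M(2)[OF v] by linarith
  qed
qed

text \<open>The component \<open>z\<close> of \<open>p\<close> orthogonal to the range changes
  neither the objective nor \<open>K_adj\<close> on the regions, and outside them there is a margin.
  A small part of \<open>z\<close> can thus be removed while staying optimal, which would reduce the
  norm unless \<open>z = 0\<close>.\<close>

lemma min_norm_dual_interp_solution_in_range:
  fixes x :: "'n::finite \<Rightarrow> real^'d" and w :: "'N::finite \<Rightarrow> real^'d"
  assumes p: "min_norm_dual_interp_solution x (region_adj x \<pi> v) p"
    and w: "\<And>i. w i \<in> dual_region x (\<pi> i)"
    and ns: "\<And>v. v \<in> unit_sphere - range w \<Longrightarrow> \<bar>K_adj x p v\<bar> < 1"
  shows "p \<in> range (region_adj x \<pi>)"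
proof -
  let ?y = "region_adj x \<pi> v"
  have sol: "p \<in> dual_interp_solutions x ?y"
    and min: "\<And>q. q \<in> dual_interp_solutions x ?y \<Longrightarrow> norm p \<le> norm q"
    using p by (auto simp: min_norm_dual_interp_solution_def is_arg_min_def not_less)
  have feas: "\<And>u. u \<in> unit_sphere \<Longrightarrow> \<bar>K_adj x p u\<bar> \<le> 1"
    using sol by (auto simp: dual_interp_solutions_def is_arg_max_def dual_feasible_def
      sphere_sup_norm_le_iff)
  obtain a z where a: "a \<in> span (range (region_adj x \<pi>))"
    and z: "\<And>u. u \<in> span (range (region_adj x \<pi>)) \<Longrightarrow> orthogonal z u" and p_eq: "p = a + z"
    using orthogonal_subspace_decomp_exists[of "range (region_adj x \<pi>)" p] by blast
  have az: "a \<bullet> z = 0" using z[OF a] by (simp add: orthogonal_def inner_commute)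
  have zadj: "z \<bullet> region_adj x \<pi> u = 0" for u
    using z[OF span_base, of "region_adj x \<pi> u"] by (simp add: orthogonal_def)
  \<comment> \<open>Orthogonality to the range is tested at the vector
    \<open>region_map x \<pi> z\<close> itself.\<close>
  have "region_map x \<pi> z \<bullet> region_map x \<pi> z = 0"
    using zadj[of "region_map x \<pi> z"] by (simp add: inner_region_adj)
  then have mz: "region_map x \<pi> z = 0" by simp
  obtain \<delta> where \<delta>: "\<delta> > 0" "\<And>q v. norm (q - p) < \<delta> \<Longrightarrow>
      v \<in> unit_sphere - (\<Union>i. dual_region x (\<pi> i)) \<Longrightarrow> \<bar>K_adj x q v\<bar> < 1"
    using nonsaturated_perturbation[of w x \<pi> p, OF w ns] by blast
  \<comment> \<open>The step stays below the margin \<open>\<delta>\<close> and does not pass beyond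
    \<open>a\<close>; the added 1 covers the case \<open>z = 0\<close>.\<close>
  define t where "t = min 1 (\<delta> / (2 * (norm z + 1)))"
  have t: "0 < t" "t \<le> 1" using \<delta> by (auto simp: t_def add_nonneg_pos intro!: divide_pos_pos)
  have "t * norm z \<le> \<delta> / (2 * (norm z + 1)) * (norm z + 1)"
    using \<delta> by (intro mult_mono) (auto simp: t_def)
  also have "\<dots> = \<delta> / 2"
  proof -
    have "b / (2 * k) * k = b / 2" if "k > 0" for b k :: real using that by simp
    then show ?thesis by (simp only: add_nonneg_pos[OF norm_ge_zero zero_less_one])
  qed
  also have "\<dots> < \<delta>" using \<delta>(1) by simp
  finally have tz: "t * norm z < \<delta>" .
  define q where "q = p - t *\<^sub>R z"
  have mq: "region_map x \<pi> q = region_map x \<pi> p"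
    by (simp add: q_def linear_diff[OF linear_region_map] linear_cmul[OF linear_region_map] mz)
  have "\<bar>K_adj x q u\<bar> \<le> 1" if u: "u \<in> unit_sphere" for u
  proof (cases "\<exists>i. u \<in> dual_region x (\<pi> i)")
    case True
    then obtain i where "u \<in> dual_region x (\<pi> i)" by blast
    from K_adj_dual_region[of u x \<pi> i, OF this] show ?thesis using feas[OF u] by (simp add: mq)
  next
    case False
    then have "\<bar>K_adj x q u\<bar> < 1" using \<delta>(2)[of q u] tz t u by (simp add: q_def)
    then show ?thesis by simp
  qed
  then have "q \<in> dual_feasible x" by (simp add: dual_feasible_def sphere_sup_norm_le_iff)
  moreover have "q \<bullet> ?y = p \<bullet> ?y" by (simp add: q_def inner_diff_left zadj)
  ultimately have "q \<in> dual_interp_solutions x ?y"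
    using sol by (auto simp: dual_interp_solutions_def is_arg_max_def)
  then have "(norm p)\<^sup>2 \<le> (norm q)\<^sup>2" using min by (simp add: power_mono)
  moreover have "(norm p)\<^sup>2 = a \<bullet> a + z \<bullet> z"
    unfolding power2_norm_eq_inner p_eq using az
    by (simp add: inner_add_left inner_add_right inner_commute[of z a])
  moreover have "q = a + (1 - t) *\<^sub>R z" by (simp add: q_def p_eq algebra_simps)
  then have "(norm q)\<^sup>2 = a \<bullet> a + (1 - t) * ((1 - t) * (z \<bullet> z))"
    unfolding power2_norm_eq_inner using az
    by (simp add: inner_add_left inner_add_right inner_commute[of z a])
  \<comment> \<open>Minimality says
    \<open>z \<bullet> z \<le> (1 - t)\<^sup>2 * (z \<bullet> z)\<close>, and
    \<open>1 - (1 - t)\<^sup>2 = t * (2 - t)\<close> is positive.\<close>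
  ultimately have "t * ((2 - t) * (z \<bullet> z)) \<le> 0" by (simp add: algebra_simps)
  then have "(2 - t) * (z \<bullet> z) \<le> 0" using t by (simp add: mult_le_0_iff)
  then have "z \<bullet> z \<le> 0" using t by (simp add: mult_le_0_iff)
  then have "z = 0" by (simp flip: power2_norm_eq_inner)
  then have "p \<in> span (range (region_adj x \<pi>))" using a p_eq by simp
  then show ?thesis
    by (simp add: span_eq_iff[THEN iffD2, OF linear_subspace_image[OF linear_region_adj subspace_UNIV]])
qed

text \<open>The group-lasso functional obtained from \<open>(P\<^sub>\<lambda>)\<close> by merging the weight and the position of
  every spike into one vector.\<close>

lemma group_lasso_stationary:
  fixes T :: "real^'d^'N::finite \<Rightarrow> real^'n::finite"
  assumes T: "linear T" and r: "0 < r"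
    and min: "\<And>u. u \<in> ball v r \<Longrightarrow>
      1 / 2 * (norm (T v - y))\<^sup>2 + lam * (\<Sum>i\<in>UNIV. norm (v $ i)) \<le>
      1 / 2 * (norm (T u - y))\<^sup>2 + lam * (\<Sum>i\<in>UNIV. norm (u $ i))"
    and nz: "\<And>i. v $ i \<noteq> 0"
  shows "(y - T v) \<bullet> T h = lam * (\<Sum>i\<in>UNIV. sgn (v $ i) \<bullet> h $ i)"
proof -
  let ?J = "\<lambda>u. 1 / 2 * (norm (T u - y))\<^sup>2 + lam * (\<Sum>i\<in>UNIV. norm (u $ i))"
  let ?D = "\<lambda>h. (T v - y) \<bullet> T h + lam * (\<Sum>i\<in>UNIV. sgn (v $ i) \<bullet> h $ i)"
  have dT: "(T has_derivative T) (at v)"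
    using T by (simp add: linear_imp_has_derivative)
  \<comment> \<open>The block norms are differentiable here because no block of \<open>v\<close>
    vanishes.\<close>
  have dn: "((\<lambda>u. norm (u $ i)) has_derivative (\<lambda>h. sgn (v $ i) \<bullet> h $ i)) (at v)" for i
  proof -
    have "((\<lambda>u. u $ i) has_derivative (\<lambda>h. h $ i)) (at v)"
      by (rule bounded_linear_imp_has_derivative[OF bounded_linear_vec_nth])
    from has_derivative_compose[OF this has_derivative_norm[OF nz[of i]]]
    show ?thesis by (simp add: inner_commute)
  qed
  have "((\<lambda>u. 1 / 2 * ((T u - y) \<bullet> (T u - y))) has_derivative (\<lambda>h. (T v - y) \<bullet> T h)) (at v)"
    by (rule derivative_eq_intros dT refl)+ (simp add: fun_eq_iff inner_commute)
  moreover have "((\<lambda>u. lam * (\<Sum>i\<in>UNIV. norm (u $ i))) has_derivative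
      (\<lambda>h. lam * (\<Sum>i\<in>UNIV. sgn (v $ i) \<bullet> h $ i))) (at v)"
    by (intro has_derivative_mult_right has_derivative_sum dn)
  ultimately have "(?J has_derivative ?D) (at v)"
    unfolding power2_norm_eq_inner by (rule has_derivative_add)
  then have "?D = (\<lambda>h. 0)"
    by (rule differential_zero_maxmin[of v "ball v r", rotated 2]) (use r min in auto)
  from fun_cong[OF this, of h] show ?thesis by (simp add: inner_diff_left)
qed

text \<open>Here \<open>u\<close> is the displacement from the reference vector. The data term grows
  at least quadratically in \<open>u\<close>, with factor \<open>m\<^sup>2\<close>, whereas the
  penalty can decrease only linearly with factor \<open>lam\<close>, so a displacement that is large
  compared with \<open>lam\<close> cannot pay off.\<close>

lemma group_lasso_minimizer_bound:
  fixes u :: "'a::real_normed_vector^'N::finite" and Tu \<zeta> :: "'b::real_inner"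
  assumes lam: "0 < lam" and m: "0 < m" "m * norm u \<le> norm Tu" and \<zeta>: "norm \<zeta> \<le> lam"
    and le: "1 / 2 * (norm (Tu - \<zeta>))\<^sup>2 \<le> 1 / 2 * (norm \<zeta>)\<^sup>2 + lam * (\<Sum>i\<in>UNIV. norm (u $ i))"
  shows "norm u \<le> (1 + (4 + 4 * real CARD('N)) / m\<^sup>2) * lam"
proof (rule ccontr)
  let ?N = "real CARD('N)"
  assume "\<not> ?thesis"
  then have gt: "(1 + (4 + 4 * ?N) / m\<^sup>2) * lam < norm u" by simp
  have "lam \<le> (1 + (4 + 4 * ?N) / m\<^sup>2) * lam" using lam m by (simp add: algebra_simps)
  \<comment> \<open>The summand 1 in the constant serves to give \<open>lam < norm u\<close>, by
    which the squared noise is absorbed into \<open>lam * norm u\<close>.\<close>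
  then have lu: "lam < norm u" using gt by simp
  have "(4 + 4 * ?N) / m\<^sup>2 * lam < norm u" using gt lam by (simp add: algebra_simps)
  then have gt': "(4 + 4 * ?N) * lam < m\<^sup>2 * norm u" using m by (simp add: field_simps)
  have "(\<Sum>i\<in>UNIV. norm (u $ i)) \<le> (\<Sum>i\<in>(UNIV::'N set). norm u)"
    by (intro sum_mono) (rule Finite_Cartesian_Product.norm_nth_le)
  then have "lam * (\<Sum>i\<in>UNIV. norm (u $ i)) \<le> lam * (?N * norm u)"
    using lam by (intro mult_left_mono) auto
  moreover have "(m * norm u)\<^sup>2 \<le> (norm Tu)\<^sup>2" using m by (intro power_mono) auto
  moreover have "(norm Tu)\<^sup>2 \<le> 2 * (norm (Tu - \<zeta>))\<^sup>2 + 2 * (norm \<zeta>)\<^sup>2"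
  proof -
    have "(norm Tu)\<^sup>2 \<le> (norm (Tu - \<zeta>) + norm \<zeta>)\<^sup>2"
      using norm_triangle_ineq[of "Tu - \<zeta>" \<zeta>] by (intro power_mono) auto
    then show ?thesis using sum_squares_bound[of "norm (Tu - \<zeta>)" "norm \<zeta>"]
      by (simp add: power2_sum)
  qed
  moreover have "(norm \<zeta>)\<^sup>2 \<le> lam * norm u"
    unfolding power2_eq_square using lam \<zeta> lu by (intro mult_mono) auto
  ultimately have "(m * norm u)\<^sup>2 \<le> 4 * (lam * norm u) + 4 * (lam * (?N * norm u))"
    using le by linarith
  then have "norm u * (m\<^sup>2 * norm u) \<le> norm u * ((4 + 4 * ?N) * lam)"
    by (simp add: power2_eq_square algebra_simps)
  then show False using gt' lu lam by (simp add: mult_le_cancel_left)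
qed

text \<open>Inserting \<open>a\<close> divided by \<open>norm b\<close> leaves two terms, each at
  most \<open>norm (a - b) / norm b\<close>. This turns closeness of the merged vectors into
  closeness of the positions on the sphere.\<close>

lemma norm_sgn_diff_le:
  fixes a b :: "'a::real_normed_vector"
  assumes "a \<noteq> 0" "b \<noteq> 0"
  shows "norm (sgn a - sgn b) \<le> 2 * norm (a - b) / norm b"
proof -
  have "sgn a - sgn b = inverse (norm b) *\<^sub>R (a - b) + (inverse (norm a) - inverse (norm b)) *\<^sub>R a"
    by (simp add: sgn_div_norm algebra_simps)
  also have "norm \<dots> \<le> inverse (norm b) * norm (a - b) + \<bar>inverse (norm a) - inverse (norm b)\<bar> * norm a"
    by (rule order_trans[OF norm_triangle_ineq]) simp
  also have "\<bar>inverse (norm a) - inverse (norm b)\<bar> * norm a = \<bar>norm b - norm a\<bar> / norm b"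
  proof -
    have "\<bar>inverse (norm a) - inverse (norm b)\<bar> * norm a =
        \<bar>(inverse (norm a) - inverse (norm b)) * norm a\<bar>" by (simp add: abs_mult)
    also have "(inverse (norm a) - inverse (norm b)) * norm a = (norm b - norm a) / norm b"
      using assms by (simp add: field_simps)
    finally show ?thesis by simp
  qed
  also have "\<dots> \<le> norm (a - b) / norm b"
    by (intro divide_right_mono) (use norm_triangle_ineq3[of b a] in \<open>auto simp: norm_minus_commute\<close>)
  finally show ?thesis by (simp add: field_simps)
qed

text \<open>The certificate identity is a vanishing sum of the slacks
  \<open>1 - s i * K_adj x p (w i)\<close> with positive weights; since no slack is negative, each
  is 0.\<close>

lemma spike_certificate_signs:
  fixes w :: "'N::finite \<Rightarrow> real^'d"
  assumes cert: "dual_certificate (K_adj x p) (spike_measure c s w)"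
    and w: "\<And>i. w i \<in> unit_sphere" and inj: "inj w"
    and c: "\<And>i. c i > 0" and s: "\<And>i. s i \<in> {-1, 1}"
  shows "K_adj x p (w i) = s i"
proof -
  let ?\<eta> = "K_adj x p"
  have s_abs: "\<bar>s i\<bar> = 1" for i using s[of i] by auto
  have le: "\<bar>?\<eta> (w i)\<bar> \<le> 1" for i
    using cert w[of i] unfolding dual_certificate_def sphere_sup_norm_le_iff by blast
  have "(\<Sum>i\<in>UNIV. c i * s i * ?\<eta> (w i)) = (\<Sum>i\<in>UNIV. \<bar>c i * s i\<bar>)"
    using cert unfolding dual_certificate_def tv_norm_spike_measure[of w, OF w inj]
    by (simp add: signed_integral_spike_measure[of w, OF w borel_measurable_K_adj])
  moreover have "\<bar>c i * s i\<bar> = c i" for i using c[of i] s_abs[of i] by (simp add: abs_mult)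
  ultimately have sum0: "(\<Sum>i\<in>UNIV. c i * (1 - s i * ?\<eta> (w i))) = 0"
    by (simp add: right_diff_distrib sum_subtractf mult.assoc)
  have nn: "0 \<le> c i * (1 - s i * ?\<eta> (w i))" for i
    using c[of i] le[of i] s[of i] by (intro mult_nonneg_nonneg) auto
  have "c i * (1 - s i * ?\<eta> (w i)) = 0"
    using sum0 nn by (simp add: sum_nonneg_eq_0_iff)
  then show ?thesis using c[of i] s[of i] by auto
qed

text \<open>On its region \<open>s i\<close> times the certificate is linear and attains its maximum
  1 over the sphere at \<open>w i\<close>, so \<open>dual_region_le_imp_eq\<close> identifies its
  coefficient vector.\<close>

lemma spike_certificate_region_map:
  fixes w :: "'N::finite \<Rightarrow> real^'d"
  assumes w: "\<And>i. w i \<in> dual_region x (\<pi> i) \<inter> unit_sphere"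
    and le: "\<And>v. v \<in> unit_sphere \<Longrightarrow> \<bar>K_adj x p v\<bar> \<le> 1"
    and s: "\<And>i. s i \<in> {-1, 1}" and eq: "\<And>i. K_adj x p (w i) = s i"
  shows "region_map x \<pi> p $ i = s i *\<^sub>R w i"
proof -
  have wi: "w i \<in> dual_region x (\<pi> i)" "w i \<in> unit_sphere" using w[of i] by auto
  have ss: "s i * s i = 1" using s[of i] by auto
  let ?b = "s i *\<^sub>R region_map x \<pi> p $ i"
  have b: "?b \<bullet> v = s i * K_adj x p v" if "v \<in> dual_region x (\<pi> i)" for v
    using K_adj_dual_region[of v x \<pi> i p] that by simp
  have "?b = w i"
  proof (rule dual_region_le_imp_eq[OF wi(2) open_dual_region wi(1)])
    show "?b \<bullet> w i = 1" using b[OF wi(1)] eq[of i] ss by simp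
    fix v assume "v \<in> dual_region x (\<pi> i) \<inter> unit_sphere"
    then show "?b \<bullet> v \<le> 1" using b[of v] le[of v] s[of i] by auto
  qed
  then have "s i *\<^sub>R ?b = s i *\<^sub>R w i" by simp
  then show ?thesis by (simp add: ss)
qed

text \<open>By \<open>crit\<close> the certificate on region \<open>i\<close> is the inner product
  with \<open>w i\<close> up to sign, so Cauchy-Schwarz bounds it by 1 with equality at
  \<open>w i\<close> only; off the regions \<open>ns\<close> is strict. Every minimiser thus lives
  on the spikes, and injectivity of \<open>region_adj\<close> fixes its weights.\<close>

lemma training_solution_spike_measure:
  fixes x :: "'n::finite \<Rightarrow> real^'d" and c s :: "'N::finite \<Rightarrow> real"
  assumes surj: "surj (region_map x \<pi>)" and lam: "lam > 0"
    and w: "\<And>i. w i \<in> dual_region x (\<pi> i) \<inter> unit_sphere"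
    and c: "\<And>i. c i > 0" and s: "\<And>i. s i \<in> {-1, 1}"
    and res: "region_adj x \<pi> (\<chi> i. (c i * s i) *\<^sub>R w i) = y - lam *\<^sub>R p"
    and crit: "\<And>i. region_map x \<pi> p $ i = s i *\<^sub>R w i"
    and ns: "\<And>v. v \<in> unit_sphere - (\<Union>i. dual_region x (\<pi> i)) \<Longrightarrow> \<bar>K_adj x p v\<bar> < 1"
  shows "training_solution x lam y \<nu> \<longleftrightarrow> \<nu> = spike_measure c s w"
    and "spike_measure c s w = spike_measure c' s w' \<and>
         (\<forall>i. w' i \<in> dual_region x (\<pi> i) \<inter> unit_sphere \<and>
              K_adj x (training_dual_solution x lam y) (w' i) = s i \<and> c' i > 0) \<longleftrightarrow>
         c' = c \<and> w' = w"
proof -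
  let ?\<mu> = "spike_measure c s w"
  have wr: "w i \<in> dual_region x (\<pi> i)" and ws: "w i \<in> unit_sphere" for i using w[of i] by auto
  have ww: "w i \<bullet> w i = 1" for i using ws[of i] by (simp flip: power2_norm_eq_inner)
  have ss: "s i * s i = 1" and s0: "s i \<noteq> 0" for i using s[of i] by auto
  have inj: "inj w" by (rule inj_dual_region_points[OF surj_region_map_imp_inj[OF surj] wr])
  have \<mu>: "?\<mu> \<in> signed_measures sphere_borel" by (rule spike_measure_signed_measures)
  have K\<mu>: "K_op x (spike_measure c' s w') = region_adj x \<pi> (\<chi> i. (c' i * s i) *\<^sub>R w' i)"
    if "\<And>i. w' i \<in> dual_region x (\<pi> i) \<inter> unit_sphere" for c' w'
    by (rule K_op_spike_measure_dual_region[of w' x \<pi>, OF that])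
  have \<eta>_region: "K_adj x p v = s i * (w i \<bullet> v)" if "v \<in> dual_region x (\<pi> i)" for v i
    using K_adj_dual_region[of v x \<pi> i p, OF that] crit[of i] by simp
  have \<eta>_w: "K_adj x p (w i) = s i" for i using \<eta>_region[OF wr] by (simp add: ww)
  have le: "\<bar>K_adj x p v\<bar> \<le> 1" if v: "v \<in> unit_sphere" for v
  proof (cases "v \<in> (\<Union>i. dual_region x (\<pi> i))")
    case True
    then obtain i where "v \<in> dual_region x (\<pi> i)" by blast
    then have "\<bar>K_adj x p v\<bar> = \<bar>w i \<bullet> v\<bar>" using s[of i] by (auto simp: \<eta>_region abs_mult)
    also have "\<dots> \<le> norm (w i) * norm v" by (rule Cauchy_Schwarz_ineq2)
    finally show ?thesis using ws v by simp
  next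
    case False
    with v ns[of v] show ?thesis by simp
  qed
  have sat: "v \<in> range w" if v: "v \<in> unit_sphere" "\<bar>K_adj x p v\<bar> = 1" for v
  proof -
    have "v \<in> (\<Union>i. dual_region x (\<pi> i))" using ns[of v] v by force
    then obtain i where i: "v \<in> dual_region x (\<pi> i)" by blast
    then have "\<bar>w i \<bullet> v\<bar> = 1" using s[of i] v(2) by (auto simp: \<eta>_region abs_mult)
    then have "\<bar>w i \<bullet> v\<bar> = norm (w i) * norm v" using ws[of i] v(1) by simp
    \<comment> \<open>Equality in Cauchy-Schwarz for unit vectors leaves only these two points, and
      the second lies outside the region.\<close>
    then have "v = w i \<or> v = - w i"
      using ws[of i] v(1) by (auto simp: norm_cauchy_schwarz_abs_eq)
    then show ?thesis using i uminus_notin_dual_region[OF wr[of i]] by auto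
  qed
  have p: "p \<in> dual_feasible x"
    using le by (simp add: dual_feasible_def sphere_sup_norm_le_iff)
  have res': "K_op x ?\<mu> = y - lam *\<^sub>R p" using K\<mu>[OF w] res by simp
  have "c i * s i * K_adj x p (w i) = \<bar>c i * s i\<bar>" for i
    using c[of i] s[of i] by (auto simp: \<eta>_w)
  then have tv: "p \<bullet> K_op x ?\<mu> = tv_norm sphere_borel ?\<mu>"
    unfolding inner_K_op[OF \<mu>] signed_integral_spike_measure[of w, OF ws borel_measurable_K_adj]
      tv_norm_spike_measure[of w, OF ws inj] by simp
  have dual: "training_dual_solution x lam y = p"
    by (rule tv_norm_eq_imp_dual_optimal[OF lam \<mu> p res' tv])
  have cw: "c' = c \<and> w' = w" if w': "\<And>i. w' i \<in> dual_region x (\<pi> i) \<inter> unit_sphere"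
      and c': "\<And>i. c' i > 0" and eq: "K_op x (spike_measure c' s w') = K_op x ?\<mu>" for c' w'
  proof -
    have "region_adj x \<pi> (\<chi> i. (c' i * s i) *\<^sub>R w' i) = region_adj x \<pi> (\<chi> i. (c i * s i) *\<^sub>R w i)"
      using eq K\<mu>[OF w] K\<mu>[OF w'] by simp
    then have "(\<chi> i. (c' i * s i) *\<^sub>R w' i) = (\<chi> i. (c i * s i) *\<^sub>R w i)"
      by (rule injD[OF inj_region_adj[OF surj]])
    then have "(c' i * s i) *\<^sub>R w' i = (c i * s i) *\<^sub>R w i" for i by (simp add: vec_eq_iff)
    then have "s i *\<^sub>R ((c' i * s i) *\<^sub>R w' i) = s i *\<^sub>R ((c i * s i) *\<^sub>R w i)" for i by simp
    moreover have "s i * (a * s i) = a" for a i using ss[of i] by (simp add: algebra_simps)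
    ultimately have e: "c' i *\<^sub>R w' i = c i *\<^sub>R w i" for i by simp
    have "c' i = c i" for i
      using arg_cong[OF e[of i], of norm] c[of i] c'[of i] ws[of i] w'[of i] by simp
    moreover from this have "w' i = w i" for i using e[of i] c[of i] by simp
    ultimately show ?thesis by auto
  qed
  show "training_solution x lam y \<nu> \<longleftrightarrow> \<nu> = ?\<mu>"
    unfolding training_solution_iff[OF lam \<mu> p res' tv]
  proof
    assume \<nu>: "\<nu> \<in> signed_measures sphere_borel \<and> K_op x \<nu> = K_op x ?\<mu> \<and>
      p \<bullet> K_op x \<nu> = tv_norm sphere_borel \<nu>"
    then have \<nu>s: "\<nu> \<in> signed_measures sphere_borel" by blast
    have "signed_integral sphere_borel \<nu> (K_adj x p) = tv_norm sphere_borel \<nu>"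
      using \<nu> inner_K_op[OF \<nu>s, of p x] by simp
    from saturated_imp_spike_measure[OF \<nu>s borel_measurable_K_adj le this ws inj sat, of s] s0
    obtain c' where c': "\<nu> = spike_measure c' s w" by blast
    \<comment> \<open>\<open>cw\<close> does not apply, since the weights \<open>c'\<close> are not
      known to be positive; with the positions fixed, injectivity alone suffices.\<close>
    have "region_adj x \<pi> (\<chi> i. (c' i * s i) *\<^sub>R w i) = region_adj x \<pi> (\<chi> i. (c i * s i) *\<^sub>R w i)"
      using \<nu> K\<mu>[OF w] c' by simp
    then have "(\<chi> i. (c' i * s i) *\<^sub>R w i) = (\<chi> i. (c i * s i) *\<^sub>R w i)"
      by (rule injD[OF inj_region_adj[OF surj]])
    then have e: "(c' i * s i) *\<^sub>R w i = (c i * s i) *\<^sub>R w i" for i by (simp add: vec_eq_iff)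
    have "w i \<noteq> 0" for i using ww[of i] by auto
    then have "c' = c" using e s0 by (simp add: fun_eq_iff)
    with c' show "\<nu> = ?\<mu>" by simp
  qed (use \<mu> tv in simp)
  show "?\<mu> = spike_measure c' s w' \<and>
         (\<forall>i. w' i \<in> dual_region x (\<pi> i) \<inter> unit_sphere \<and>
              K_adj x (training_dual_solution x lam y) (w' i) = s i \<and> c' i > 0) \<longleftrightarrow>
         c' = c \<and> w' = w"
    unfolding dual
  proof
    assume "?\<mu> = spike_measure c' s w' \<and> (\<forall>i. w' i \<in> dual_region x (\<pi> i) \<inter> unit_sphere \<and>
      K_adj x p (w' i) = s i \<and> c' i > 0)"
    then show "c' = c \<and> w' = w" by (intro cw) auto
  qed (use w \<eta>_w c in auto)
qed

section \<open>Stability of the spikes\<close>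

lemma finite_pos_lower_bound:
  fixes f :: "'i::finite \<Rightarrow> real"
  assumes "\<And>i. f i > 0"
  obtains m where "m > 0" "\<And>i. m \<le> f i"
  using that[of "Min (range f)"] assms by auto

theorem theorem4p7:
  fixes x :: "'n::finite \<Rightarrow> real^'d::finite"
    and c\<^sub>0 s :: "'N::finite \<Rightarrow> real"
    and w\<^sub>0 :: "'N \<Rightarrow> real^'d"
    and \<pi> :: "'N \<Rightarrow> 'n \<Rightarrow> bool"
    and \<mu>\<^sub>0 :: "(real^'d) set \<Rightarrow> real"
    and y\<^sub>0 p\<^sub>0 :: "real^'n"
  assumes data: "\<And>j. x j \<noteq> 0"
    and N_le_n: "CARD('N) \<le> CARD('n)"
    and c\<^sub>0_pos: "\<And>i. c\<^sub>0 i > 0"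
    and signs: "\<And>i. s i \<in> {-1, 1}"
    and w\<^sub>0_region: "\<And>i. w\<^sub>0 i \<in> dual_region x (\<pi> i) \<inter> unit_sphere"
    and \<mu>\<^sub>0: "\<mu>\<^sub>0 = spike_measure c\<^sub>0 s w\<^sub>0"
    and y\<^sub>0: "y\<^sub>0 = K_op x \<mu>\<^sub>0"
    and p\<^sub>0: "min_norm_dual_interp_solution x y\<^sub>0 p\<^sub>0"
    and certificate: "dual_certificate (K_adj x p\<^sub>0) \<mu>\<^sub>0"
    and nonsaturated: "\<And>w. w \<in> unit_sphere - range w\<^sub>0 \<Longrightarrow> \<bar>K_adj x p\<^sub>0 w\<bar> < 1"
    and lin_indep: "inj (\<lambda>i. K_op x (dirac sphere_borel (w\<^sub>0 i)))"
      "independent (range (\<lambda>i. K_op x (dirac sphere_borel (w\<^sub>0 i))))"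
    and full_rank: "dim (range (\<lambda>p. (K_mat x w\<^sub>0 *v p, K_deriv x w\<^sub>0 p))) = CARD('N) * CARD('d)"
  shows "\<exists>\<alpha>>0. \<exists>lam\<^sub>0>0. \<exists>C>0. \<forall>(lam, \<zeta>) \<in> admissible \<alpha> lam\<^sub>0.
    \<exists>\<mu> c w.
      (\<forall>\<nu>. training_solution x lam (y\<^sub>0 + \<zeta>) \<nu> \<longleftrightarrow> \<nu> = \<mu>) \<and>
      (\<forall>c' w'.
        (\<mu> = spike_measure c' s w' \<and>
         (\<forall>i. w' i \<in> dual_region x (\<pi> i) \<inter> unit_sphere \<and>
              K_adj x (training_dual_solution x lam (y\<^sub>0 + \<zeta>)) (w' i) = s i \<and>
              c' i > 0)) \<longleftrightarrow> c' = c \<and> w' = w) \<and>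
      (\<forall>i. \<bar>c i - c\<^sub>0 i\<bar> \<le> C * lam \<and> norm (w i - w\<^sub>0 i) \<le> C * lam)"
proof -

  \<comment> \<open>The unperturbed problem in linearised form\<close>
  have s_abs: "\<bar>s i\<bar> = 1" and ss: "s i * s i = 1" for i using signs[of i] by auto
  have wr\<^sub>0: "w\<^sub>0 i \<in> dual_region x (\<pi> i)" and ws\<^sub>0: "w\<^sub>0 i \<in> unit_sphere" for i
    using w\<^sub>0_region[of i] by auto
  have surj: "surj (region_map x \<pi>)" by (rule surj_region_map[of w\<^sub>0, OF w\<^sub>0_region full_rank])
  have inj\<^sub>0: "inj w\<^sub>0"
    by (rule inj_dual_region_points[OF surj_region_map_imp_inj[OF surj] wr\<^sub>0])
  let ?T = "region_adj x \<pi>"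
  let ?A = "region_map x \<pi>"
  define v\<^sub>0 where "v\<^sub>0 = (\<chi> i. (c\<^sub>0 i * s i) *\<^sub>R w\<^sub>0 i)"
  have y\<^sub>0_eq: "y\<^sub>0 = ?T v\<^sub>0"
    unfolding y\<^sub>0 \<mu>\<^sub>0 v\<^sub>0_def by (rule K_op_spike_measure_dual_region[of w\<^sub>0 x \<pi>, OF w\<^sub>0_region])
  have nv\<^sub>0: "norm (v\<^sub>0 $ i) = c\<^sub>0 i" and sv\<^sub>0: "sgn (v\<^sub>0 $ i) = s i *\<^sub>R w\<^sub>0 i" for i
  proof -
    show n: "norm (v\<^sub>0 $ i) = c\<^sub>0 i"
      using c\<^sub>0_pos[of i] s_abs[of i] ws\<^sub>0[of i] by (simp add: v\<^sub>0_def abs_mult)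
    show "sgn (v\<^sub>0 $ i) = s i *\<^sub>R w\<^sub>0 i"
      unfolding sgn_div_norm n using c\<^sub>0_pos[of i] by (simp add: v\<^sub>0_def)
  qed
  have feas\<^sub>0: "\<bar>K_adj x p\<^sub>0 v\<bar> \<le> 1" if "v \<in> unit_sphere" for v
    using certificate that unfolding dual_certificate_def sphere_sup_norm_le_iff by blast
  have \<eta>\<^sub>0: "K_adj x p\<^sub>0 (w\<^sub>0 i) = s i" for i
    using spike_certificate_signs[of x p\<^sub>0 c\<^sub>0 s w\<^sub>0, OF _ ws\<^sub>0 inj\<^sub>0 c\<^sub>0_pos signs] certificate \<mu>\<^sub>0
    by blast
  have Ap\<^sub>0: "?A p\<^sub>0 $ i = s i *\<^sub>R w\<^sub>0 i" for i
    by (rule spike_certificate_region_map[of w\<^sub>0, OF w\<^sub>0_region feas\<^sub>0 signs \<eta>\<^sub>0])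
  \<comment> \<open>On the range of \<open>?T\<close> a vector is controlled by its image under
    \<open>?A\<close>; the representation by \<open>h\<close> places \<open>p\<^sub>0\<close>
    there.\<close>
  obtain h where h: "p\<^sub>0 = ?T h"
    using min_norm_dual_interp_solution_in_range[of x \<pi> v\<^sub>0 p\<^sub>0 w\<^sub>0, OF _ wr\<^sub>0 nonsaturated] p\<^sub>0
    unfolding y\<^sub>0_eq by blast
  obtain \<delta> where \<delta>: "\<delta> > 0" "\<And>q v. norm (q - p\<^sub>0) < \<delta> \<Longrightarrow>
      v \<in> unit_sphere - (\<Union>i. dual_region x (\<pi> i)) \<Longrightarrow> \<bar>K_adj x q v\<bar> < 1"
    using nonsaturated_perturbation[of w\<^sub>0 x \<pi> p\<^sub>0, OF wr\<^sub>0 nonsaturated] by blast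
  obtain m where m: "m > 0" "\<And>v. m * norm v \<le> norm (?T v)"
    using linear_inj_bounded_below_pos[OF linear_region_adj inj_region_adj[OF surj]] by blast
  obtain B where B: "B > 0" "\<And>p. norm (?A p) \<le> B * norm p"
    using linear_bounded_pos[OF linear_region_map] by blast
  obtain cm where cm: "cm > 0" "\<And>i. cm \<le> c\<^sub>0 i"
    using finite_pos_lower_bound[of c\<^sub>0, OF c\<^sub>0_pos] by blast
  have "\<exists>\<rho>>0. ball (w\<^sub>0 i) \<rho> \<subseteq> dual_region x (\<pi> i)" for i
    using open_dual_region wr\<^sub>0 open_contains_ball by blast
  then obtain \<rho>' where \<rho>': "\<And>i. \<rho>' i > 0" "\<And>i. ball (w\<^sub>0 i) (\<rho>' i) \<subseteq> dual_region x (\<pi> i)"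
    by metis
  obtain \<rho> where \<rho>: "\<rho> > 0" "\<And>i. \<rho> \<le> \<rho>' i"
    using finite_pos_lower_bound[of \<rho>', OF \<rho>'(1)] by blast
  have in_region: "v \<in> dual_region x (\<pi> i)" if "norm (v - w\<^sub>0 i) < \<rho>" for v i
  proof -
    have "v \<in> ball (w\<^sub>0 i) (\<rho>' i)" using that \<rho>(2)[of i] by (simp add: dist_norm norm_minus_commute)
    then show ?thesis using \<rho>'(2) by blast
  qed

  \<comment> \<open>Choice of the constants\<close>
  let ?N = "real CARD('N)"
  \<comment> \<open>\<open>C\<^sub>1\<close> is the constant of
    \<open>group_lasso_minimizer_bound\<close>. \<open>C\<^sub>2\<close> carries it over to
    positions by \<open>norm_sgn_diff_le\<close>, the blocks of \<open>v\<^sub>0\<close> having norm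
    at least \<open>cm\<close>.\<close>
  define C\<^sub>1 where "C\<^sub>1 = 1 + (4 + 4 * ?N) / m\<^sup>2"
  define C\<^sub>2 where "C\<^sub>2 = 2 * C\<^sub>1 / cm"
  have C\<^sub>1: "C\<^sub>1 > 0" unfolding C\<^sub>1_def by (intro add_pos_nonneg) auto
  have C\<^sub>2: "C\<^sub>2 > 0" using C\<^sub>1 cm by (simp add: C\<^sub>2_def)
  have N: "?N > 0" by simp
  \<comment> \<open>The bound 1 gives \<open>norm \<zeta> \<le> lam\<close>. The other bound limits
    the share of the noise in \<open>p - p\<^sub>0\<close>, both direct and through
    \<open>?A\<close>, to \<open>\<delta> / 3\<close>.\<close>
  define \<alpha> where "\<alpha> = min 1 (\<delta> / (3 * (B / m + 1)))"
  \<comment> \<open>In order: the minimiser stays inside its ball, the new positions stay in their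
    regions, and the movement of the spikes contributes at most \<open>\<delta> / 3\<close> to
    \<open>p - p\<^sub>0\<close>.\<close>
  define \<Lambda> where "\<Lambda> = Min {cm / (4 * C\<^sub>1), \<rho> / (2 * C\<^sub>2), \<delta> * m / (3 * ?N * C\<^sub>2)}"
  have Bm: "0 < B / m + 1" using B m by (simp add: add_pos_pos)
  have \<alpha>: "\<alpha> > 0" "\<alpha> \<le> 1" "B * \<alpha> / m + \<alpha> \<le> \<delta> / 3"
  proof -
    show "\<alpha> > 0" "\<alpha> \<le> 1" using Bm \<delta> by (auto simp: \<alpha>_def)
    have "\<alpha> * (B / m + 1) \<le> \<delta> / (3 * (B / m + 1)) * (B / m + 1)"
      using Bm by (intro mult_right_mono) (auto simp: \<alpha>_def)
    also have "\<dots> = \<delta> / 3"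
    proof -
      have "a / (3 * k) * k = a / 3" if "k > 0" for a k :: real using that by simp
      then show ?thesis using Bm .
    qed
    finally show "B * \<alpha> / m + \<alpha> \<le> \<delta> / 3" by (simp add: algebra_simps)
  qed
  have \<Lambda>: "\<Lambda> > 0" "C\<^sub>1 * \<Lambda> < cm / 2" "C\<^sub>2 * \<Lambda> < \<rho>" "?N * (C\<^sub>2 * \<Lambda>) / m \<le> \<delta> / 3"
  proof -
    show "\<Lambda> > 0" unfolding \<Lambda>_def using C\<^sub>1 C\<^sub>2 cm \<rho> \<delta> m by simp
    have "\<Lambda> \<le> cm / (4 * C\<^sub>1)" "\<Lambda> \<le> \<rho> / (2 * C\<^sub>2)" "\<Lambda> \<le> \<delta> * m / (3 * ?N * C\<^sub>2)"
      by (auto simp: \<Lambda>_def)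
    then have "C\<^sub>1 * \<Lambda> \<le> cm / 4" "C\<^sub>2 * \<Lambda> \<le> \<rho> / 2" "?N * (C\<^sub>2 * \<Lambda>) \<le> \<delta> * m / 3"
      using C\<^sub>1 C\<^sub>2 N by (simp_all add: field_simps)
    then show "C\<^sub>1 * \<Lambda> < cm / 2" "C\<^sub>2 * \<Lambda> < \<rho>" "?N * (C\<^sub>2 * \<Lambda>) / m \<le> \<delta> / 3"
      using cm \<rho> m by (simp_all add: field_simps)
  qed
  have main: "\<exists>\<mu> c w.
      (\<forall>\<nu>. training_solution x lam (y\<^sub>0 + \<zeta>) \<nu> \<longleftrightarrow> \<nu> = \<mu>) \<and>
      (\<forall>c' w'.
        (\<mu> = spike_measure c' s w' \<and>
         (\<forall>i. w' i \<in> dual_region x (\<pi> i) \<inter> unit_sphere \<and>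
              K_adj x (training_dual_solution x lam (y\<^sub>0 + \<zeta>)) (w' i) = s i \<and>
              c' i > 0)) \<longleftrightarrow> c' = c \<and> w' = w) \<and>
      (\<forall>i. \<bar>c i - c\<^sub>0 i\<bar> \<le> (C\<^sub>1 + C\<^sub>2) * lam \<and> norm (w i - w\<^sub>0 i) \<le> (C\<^sub>1 + C\<^sub>2) * lam)"
    if lam: "0 < lam" "lam \<le> \<Lambda>" and \<zeta>: "norm \<zeta> \<le> \<alpha> * lam" for lam \<zeta>
  proof -

    \<comment> \<open>The minimiser for fixed parameters\<close>
    define y where "y = y\<^sub>0 + \<zeta>"
    let ?J = "\<lambda>u. 1 / 2 * (norm (?T u - y))\<^sup>2 + lam * (\<Sum>i\<in>UNIV. norm (u $ i))"
    \<comment> \<open>Compactness of the ball provides the minimiser; \<open>u_bound\<close> then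
      shows that it is interior.\<close>
    have "continuous_on (cball v\<^sub>0 (cm / 2)) ?J"
      by (intro continuous_intros linear_continuous_on linear_conv_bounded_linear[THEN iffD1]
          linear_region_adj)
    then obtain v where v: "v \<in> cball v\<^sub>0 (cm / 2)" "\<And>u. u \<in> cball v\<^sub>0 (cm / 2) \<Longrightarrow> ?J v \<le> ?J u"
      using continuous_attains_inf[OF compact_cball, of v\<^sub>0 "cm / 2" ?J] cm(1) by auto
    have u_bound: "norm (v - v\<^sub>0) \<le> C\<^sub>1 * lam"
      unfolding C\<^sub>1_def
    proof (rule group_lasso_minimizer_bound[OF lam(1) m(1) m(2)])
      have "\<alpha> * lam \<le> 1 * lam" using \<alpha> lam by (intro mult_right_mono) auto
      then show "norm \<zeta> \<le> lam" using \<zeta> by simp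
      \<comment> \<open>The reference vector \<open>v\<^sub>0\<close> has residual
        \<open>- \<zeta>\<close>, and the penalties are compared by the reverse triangle inequality
        on each block.\<close>
      have "?J v \<le> ?J v\<^sub>0" using cm by (intro v) simp
      moreover have "?T v - y = ?T (v - v\<^sub>0) - \<zeta>" "?T v\<^sub>0 - y = - \<zeta>"
        by (simp_all add: y_def y\<^sub>0_eq linear_diff[OF linear_region_adj])
      moreover have "(\<Sum>i\<in>UNIV. norm (v\<^sub>0 $ i)) - (\<Sum>i\<in>UNIV. norm (v $ i)) \<le>
          (\<Sum>i\<in>UNIV. norm ((v - v\<^sub>0) $ i))"
        unfolding sum_subtractf[symmetric]
        by (intro sum_mono) (simp add: norm_triangle_ineq2 norm_minus_commute)
      then have "lam * ((\<Sum>i\<in>UNIV. norm (v\<^sub>0 $ i)) - (\<Sum>i\<in>UNIV. norm (v $ i))) \<le>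
          lam * (\<Sum>i\<in>UNIV. norm ((v - v\<^sub>0) $ i))"
        using lam by (intro mult_left_mono) auto
      ultimately show "1 / 2 * (norm (?T (v - v\<^sub>0) - \<zeta>))\<^sup>2 \<le>
          1 / 2 * (norm \<zeta>)\<^sup>2 + lam * (\<Sum>i\<in>UNIV. norm ((v - v\<^sub>0) $ i))"
        by (simp add: right_diff_distrib)
    qed
    have "C\<^sub>1 * lam \<le> C\<^sub>1 * \<Lambda>" "C\<^sub>2 * lam \<le> C\<^sub>2 * \<Lambda>" using C\<^sub>1 C\<^sub>2 lam by auto
    then have small: "norm (v - v\<^sub>0) < cm / 2" "C\<^sub>2 * lam < \<rho>" using u_bound \<Lambda> by linarith+
    have vi: "norm (v $ i - v\<^sub>0 $ i) \<le> C\<^sub>1 * lam" for i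
      using order_trans[OF Finite_Cartesian_Product.norm_nth_le[of "v - v\<^sub>0" i] u_bound] by simp
    have nz: "v $ i \<noteq> 0" for i
    proof
      assume "v $ i = 0"
      then have "c\<^sub>0 i \<le> C\<^sub>1 * lam" using vi[of i] nv\<^sub>0[of i] by simp
      then show False using cm(2)[of i] \<open>C\<^sub>1 * lam \<le> C\<^sub>1 * \<Lambda>\<close> \<Lambda>(2) cm(1) by simp
    qed
    define c where "c i = norm (v $ i)" for i
    \<comment> \<open>The merged vector has direction \<open>s i *\<^sub>R w i\<close>, so
      multiplying by \<open>s i\<close> once more recovers the position.\<close>
    define w where "w i = s i *\<^sub>R sgn (v $ i)" for i
    have v_eq: "(\<chi> i. (c i * s i) *\<^sub>R w i) = v"
    proof -
      have "(c i * s i) *\<^sub>R w i = v $ i" for i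
      proof -
        have "(c i * s i) *\<^sub>R w i = (norm (v $ i) * (s i * s i)) *\<^sub>R sgn (v $ i)"
          by (simp add: c_def w_def mult.assoc)
        then show ?thesis using nz[of i] by (simp add: ss sgn_div_norm)
      qed
      then show ?thesis by (simp add: vec_eq_iff)
    qed
    have w_close: "norm (w i - w\<^sub>0 i) \<le> C\<^sub>2 * lam" for i
    proof -
      have "w\<^sub>0 i = s i *\<^sub>R sgn (v\<^sub>0 $ i)" by (simp add: sv\<^sub>0 ss)
      then have "norm (w i - w\<^sub>0 i) = norm (sgn (v $ i) - sgn (v\<^sub>0 $ i))"
        by (simp add: w_def s_abs flip: scaleR_diff_right)
      also have "\<dots> \<le> 2 * norm (v $ i - v\<^sub>0 $ i) / norm (v\<^sub>0 $ i)"
        using nv\<^sub>0[of i] c\<^sub>0_pos[of i] nz by (intro norm_sgn_diff_le) auto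
      also have "\<dots> \<le> 2 * (C\<^sub>1 * lam) / cm"
        using vi[of i] cm nv\<^sub>0[of i] C\<^sub>1 lam by (intro frac_le) auto
      finally show ?thesis by (simp add: C\<^sub>2_def)
    qed
    have w: "w i \<in> dual_region x (\<pi> i) \<inter> unit_sphere" for i
    proof
      show "w i \<in> dual_region x (\<pi> i)"
        using w_close[of i] small(2) by (intro in_region) simp
      show "w i \<in> unit_sphere" using nz by (simp add: w_def s_abs norm_sgn)
    qed
    define p where "p = (y - ?T v) /\<^sub>R lam"
    have res: "?T v = y - lam *\<^sub>R p" using lam by (simp add: p_def)
    have crit: "?A p $ i = s i *\<^sub>R w i" for i
    proof -
      have "?A p \<bullet> h = (\<chi> i. sgn (v $ i)) \<bullet> h" for h
      proof -
        have "(y - ?T v) \<bullet> ?T h = lam * (\<Sum>i\<in>UNIV. sgn (v $ i) \<bullet> h $ i)"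
        proof (rule group_lasso_stationary[OF linear_region_adj _ _ nz])
          \<comment> \<open>The ball of this radius around \<open>v\<close> lies inside the ball
            over which \<open>v\<close> is minimal.\<close>
          show "0 < cm / 2 - norm (v - v\<^sub>0)" using small by simp
          fix u assume "u \<in> ball v (cm / 2 - norm (v - v\<^sub>0))"
          then have "norm (u - v) + norm (v - v\<^sub>0) < cm / 2"
            by (simp add: dist_norm norm_minus_commute)
          then have "u \<in> cball v\<^sub>0 (cm / 2)"
            using norm_triangle_ineq[of "u - v" "v - v\<^sub>0"] by (simp add: dist_norm norm_minus_commute)
          then show "?J v \<le> ?J u" by (rule v(2))
        qed
        then have "p \<bullet> ?T h = (\<Sum>i\<in>UNIV. sgn (v $ i) \<bullet> h $ i)" using lam by (simp add: p_def)
        then show ?thesis by (simp add: inner_region_adj inner_vec_def[of "\<chi> i. sgn (v $ i)"])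
      qed
      then have "?A p = (\<chi> i. sgn (v $ i))" using vector_eq_rdot by blast
      then show ?thesis by (simp add: w_def ss)
    qed
    have "norm (p - p\<^sub>0) < \<delta>"
    proof -
      \<comment> \<open>Both \<open>y\<^sub>0\<close> and \<open>p\<^sub>0\<close> lie in the range
        of \<open>?T\<close>, so up to the scaled noise the difference \<open>p - p\<^sub>0\<close>
        is an image \<open>?T g\<close>.\<close>
      define g where "g = (v\<^sub>0 - v) /\<^sub>R lam - h"
      have p_eq: "p - p\<^sub>0 = ?T g + \<zeta> /\<^sub>R lam"
        by (simp add: p_def y_def y\<^sub>0_eq h g_def linear_diff[OF linear_region_adj]
            linear_add[OF linear_region_adj] linear_cmul[OF linear_region_adj] algebra_simps)
      have \<zeta>': "norm (\<zeta> /\<^sub>R lam) \<le> \<alpha>" using \<zeta> lam by (simp add: field_simps)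
      have "norm (?A (p - p\<^sub>0)) \<le> (\<Sum>i\<in>UNIV. norm (?A (p - p\<^sub>0) $ i))"
        unfolding norm_vec_def by (rule L2_set_le_sum) simp
      also have "\<dots> \<le> (\<Sum>i\<in>(UNIV::'N set). C\<^sub>2 * lam)"
      proof (rule sum_mono)
        fix i
        have "?A (p - p\<^sub>0) $ i = s i *\<^sub>R (w i - w\<^sub>0 i)"
          by (simp add: linear_diff[OF linear_region_map] crit Ap\<^sub>0 scaleR_diff_right)
        then show "norm (?A (p - p\<^sub>0) $ i) \<le> C\<^sub>2 * lam" using w_close[of i] by (simp add: s_abs)
      qed
      also have "\<dots> = ?N * (C\<^sub>2 * lam)" by simp
      also have "\<dots> \<le> ?N * (C\<^sub>2 * \<Lambda>)" using C\<^sub>2 lam by simp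
      finally have Ap: "norm (?A (p - p\<^sub>0)) \<le> ?N * (C\<^sub>2 * \<Lambda>)" .
      have A\<zeta>: "norm (?A (\<zeta> /\<^sub>R lam)) \<le> B * \<alpha>"
        using B \<zeta>' by (meson mult_left_mono less_imp_le order_trans)
      \<comment> \<open>Moving \<open>?T\<close> to the other side of the inner product brings in
        \<open>?A (?T g)\<close>, which is known to be small; the factor \<open>norm g\<close> is
        bounded by \<open>norm (?T g) / m\<close>, and one factor \<open>norm (?T g)\<close>
        cancels.\<close>
      have "(norm (?T g))\<^sup>2 = (?A (p - p\<^sub>0) - ?A (\<zeta> /\<^sub>R lam)) \<bullet> g"
        unfolding power2_norm_eq_inner inner_region_adj
        by (simp add: p_eq linear_add[OF linear_region_map])
      also have "\<dots> \<le> norm (?A (p - p\<^sub>0) - ?A (\<zeta> /\<^sub>R lam)) * norm g"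
        by (rule norm_cauchy_schwarz)
      also have "\<dots> \<le> (?N * (C\<^sub>2 * \<Lambda>) + B * \<alpha>) * (norm (?T g) / m)"
      proof (rule mult_mono)
        show "norm (?A (p - p\<^sub>0) - ?A (\<zeta> /\<^sub>R lam)) \<le> ?N * (C\<^sub>2 * \<Lambda>) + B * \<alpha>"
          using norm_triangle_ineq4[of "?A (p - p\<^sub>0)" "?A (\<zeta> /\<^sub>R lam)"] Ap A\<zeta> by linarith
        show "norm g \<le> norm (?T g) / m" using m by (simp add: field_simps)
      qed (use C\<^sub>2 \<Lambda> B \<alpha> in auto)
      finally have "norm (?T g) * norm (?T g) \<le> norm (?T g) * (?N * (C\<^sub>2 * \<Lambda>) / m + B * \<alpha> / m)"
        by (simp add: power2_eq_square field_simps add_divide_distrib)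
      moreover have "0 \<le> ?N * (C\<^sub>2 * \<Lambda>) / m + B * \<alpha> / m"
        using C\<^sub>2 \<Lambda> B \<alpha> m by auto
      ultimately have "norm (?T g) \<le> ?N * (C\<^sub>2 * \<Lambda>) / m + B * \<alpha> / m"
        by (cases "?T g = 0") auto
      then have "norm (p - p\<^sub>0) \<le> ?N * (C\<^sub>2 * \<Lambda>) / m + B * \<alpha> / m + \<alpha>"
        unfolding p_eq using norm_triangle_ineq[of "?T g" "\<zeta> /\<^sub>R lam"] \<zeta>' by linarith
      then show ?thesis using \<Lambda>(4) \<alpha>(3) \<delta>(1) by linarith
    qed
    then have ns: "\<bar>K_adj x p v\<bar> < 1" if "v \<in> unit_sphere - (\<Union>i. dual_region x (\<pi> i))" for v
      using \<delta>(2) that by blast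
    have c_pos: "c i > 0" for i using nz by (simp add: c_def)
    \<comment> \<open>One constant has to serve both weights and positions.\<close>
    have le: "C\<^sub>1 * lam \<le> (C\<^sub>1 + C\<^sub>2) * lam" "C\<^sub>2 * lam \<le> (C\<^sub>1 + C\<^sub>2) * lam"
      using C\<^sub>1 C\<^sub>2 lam by auto
    have c_close: "\<bar>c i - c\<^sub>0 i\<bar> \<le> C\<^sub>1 * lam" for i
      unfolding c_def nv\<^sub>0[symmetric] by (rule order_trans[OF norm_triangle_ineq3 vi])
    note sol = training_solution_spike_measure[of x \<pi> lam w c s y p, OF surj lam(1) w c_pos signs
        res[folded v_eq] crit ns]
    show ?thesis
      unfolding y_def[symmetric]
      by (intro exI[of _ "spike_measure c s w"] exI[of _ c] exI[of _ w] conjI allI sol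
          order_trans[OF c_close le(1)] order_trans[OF w_close le(2)])
  qed
  show ?thesis
    using \<alpha>(1) \<Lambda>(1) C\<^sub>1 C\<^sub>2 main unfolding admissible_def
    by (intro exI[of _ \<alpha>] exI[of _ \<Lambda>] exI[of _ "C\<^sub>1 + C\<^sub>2"] conjI) auto
qed

end
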